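(* Let $k>1$ and $s\ge 1$ be integers with $s\le\lfloor k/2\rfloor$. Then for all integers $n\ge 0$: \begin{align*} p_{[1,2;-(3^{k}-5b)/b]}\left(3^{2s} n+3^{2s-1} r+\frac{7\cdot 3^{2s-1}-5}{8}\right)&\equiv 0 \pmod{3^{k}}, && r\in\{0,2\},\\ p_{[1,2;-(5^{k}-3b)/b]}\left(5^{2s} n+5^{2s-1} r+\frac{7\cdot 5^{2s-1}-3}{8}\right)&\equiv 0 \pmod{5^{k}}, && r\in\{0,2,3,4\},\\ p_{[1,3;-(5^{k}-3b)/b]}\left(5^{2s} n+5^{2s-1} r+\frac{5^{2s-1}-1}{2}\right)&\equiv 0 \pmod{5^{k}}, && r\in\{0,1,3,4\}, \end{align*} where in each congruence $b$ is any positive integer coprime to the modulus (i.e. to $3$, $5$, $5$ respectively).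
   Context: For a rational number $t$ and an integer $m>1$, the rational numbers $p_{[1,m;t]}(n)$, $n\ge 0$, are defined by the formal power series identity $\sum_{n\ge 0}p_{[1,m;t]}(n)q^n=\prod_{j\ge 1}\big((1-q^j)(1-q^{mj})\big)^t$, where each power is the binomial series with constant term $1$. For a prime $\ell$ not dividing the denominator of $t$, a congruence $p_{[1,m;t]}(N)\equiv 0\pmod{\ell^k}$ means that the numerator of $p_{[1,m;t]}(N)$, written as a reduced fraction, is divisible by $\ell^k$ (the denominator is then coprime to $\ell$). *)

theory Defs
  imports "HOL-Analysis.Infinite_Products" "HOL-Computational_Algebra.Formal_Power_Series"
begin

unbundle no vec_syntax
unbundle fps_syntax

text \<open>
  The rational power \<open>f\<^sup>t\<close> is the binomial series \<open>\<Sum>i. (t gchoose i) (f - 1)\<^sup>i\<close>;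
  this is meaningful only for \<open>f\<close> with constant term 1.
\<close>

definition fps_rat_power :: "rat fps \<Rightarrow> rat \<Rightarrow> rat fps" where
  "fps_rat_power f t = fps_compose (fps_binomial t) (f - 1)"

text \<open>
  The infinite product is the limit in the metric of the type of formal power series, i.e.
  coefficientwise stabilisation; it converges for \<open>m \<ge> 1\<close> by \<open>has_prod_euler_power\<close> below.
  The factors are those with index \<open>Suc j\<close>, since \<open>j\<close> starts at 0.
\<close>

definition euler_power :: "nat \<Rightarrow> rat \<Rightarrow> rat fps" where
  "euler_power m t =
     (\<Prod>j. fps_rat_power ((1 - fps_X ^ Suc j) * (1 - fps_X ^ (m * Suc j))) t)"

text \<open>\<open>p1 m t n\<close> is the number \<open>p\<close> with index \<open>[1,m;t]\<close> at \<open>n\<close>.\<close>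

definition p1 :: "nat \<Rightarrow> rat \<Rightarrow> nat \<Rightarrow> rat" where
  "p1 m t n = euler_power m t $ n"

text \<open>
  \<open>x \<equiv> 0 (mod d)\<close> for rational \<open>x\<close>: \<open>d\<close> divides the numerator of the reduced fraction.
\<close>

definition rat_cong_0 :: "rat \<Rightarrow> nat \<Rightarrow> bool" where
  "rat_cong_0 x d \<longleftrightarrow> int d dvd fst (quotient_of x)"


lemma fps_rat_power_nth_0: "fps_rat_power f t $ 0 = 1"
  by (simp add: fps_rat_power_def fps_compose_def)

lemma fps_rat_power_nth_low:
  assumes "\<And>i. i \<le> n \<Longrightarrow> f $ i = (1 :: rat fps) $ i" and "0 < n"
  shows   "fps_rat_power f t $ n = 0"
proof -
  have "((f - 1) ^ i) $ n = 0" for i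
  proof (cases i)
    case (Suc i')
    have "((f - 1) * (f - 1) ^ i') $ n = (\<Sum>l=0..n. (f - 1) $ l * ((f - 1) ^ i') $ (n - l))"
      by (rule fps_mult_nth)
    also have "\<dots> = 0"
    proof (rule sum.neutral, rule ballI)
      fix l assume "l \<in> {0..n}"
      then have "(f - 1) $ l = 0" by (simp add: assms(1) del: fps_one_nth)
      then show "(f - 1) $ l * ((f - 1) ^ i') $ (n - l) = 0" by simp
    qed
    finally show ?thesis by (simp add: Suc)
  qed (use assms in simp)
  then show ?thesis by (simp add: fps_rat_power_def fps_compose_def)
qed

lemma has_prod_fps:
  fixes f :: "nat \<Rightarrow> rat fps"
  assumes f0: "\<And>j. f j $ 0 = 1" and low: "\<And>j n. 0 < n \<Longrightarrow> n \<le> j \<Longrightarrow> f j $ n = 0"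
  shows   "f has_prod Abs_fps (\<lambda>n. (\<Prod>j\<le>n. f j) $ n)"
proof -
  define P where "P = Abs_fps (\<lambda>n. (\<Prod>j\<le>n. f j) $ n)"
  have stable: "(\<Prod>j\<le>i+d. f j) $ i = (\<Prod>j\<le>i. f j) $ i" for i d
  proof (induction d)
    case (Suc d)
    have "(\<Prod>j\<le>i + Suc d. f j) $ i =
            (\<Sum>l=0..i. (\<Prod>j\<le>i+d. f j) $ l * f (Suc (i+d)) $ (i - l))"
      by (simp add: fps_mult_nth)
    also have "\<dots> = (\<Sum>l=0..i. if l = i then (\<Prod>j\<le>i+d. f j) $ l else 0)"
      by (intro sum.cong) (auto simp: f0 low)
    also have "\<dots> = (\<Prod>j\<le>i+d. f j) $ i" by simp
    finally show ?case using Suc by simp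
  qed simp
  have "(\<lambda>n. \<Prod>j\<le>n. f j) \<longlonglongrightarrow> P"
  proof (rule tendsto_fpsI)
    fix i
    have "(\<Prod>j\<le>n. f j) $ i = P $ i" if "n \<ge> i" for n
      using stable[of i "n - i"] that by (simp add: P_def)
    then show "\<forall>\<^sub>F n in sequentially. (\<Prod>j\<le>n. f j) $ i = P $ i"
      by (auto simp: eventually_at_top_linorder)
  qed
  moreover have "P $ 0 = 1" by (simp add: P_def f0)
  then have "P \<noteq> 0" by auto
  ultimately show ?thesis by (simp add: has_prod_def raw_has_prod_def P_def)
qed

lemma has_prod_euler_power:
  assumes "m \<ge> 1"
  shows "(\<lambda>j. fps_rat_power ((1 - fps_X ^ Suc j) * (1 - fps_X ^ (m * Suc j))) t)
           has_prod euler_power m t"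
proof -
  let ?f = "\<lambda>j. fps_rat_power ((1 - fps_X ^ Suc j) * (1 - fps_X ^ (m * Suc j))) t"
  have "?f has_prod Abs_fps (\<lambda>n. (\<Prod>j\<le>n. ?f j) $ n)"
  proof (rule has_prod_fps)
    fix j n :: nat
    assume n: "0 < n" "n \<le> j"
    show "?f j $ n = 0"
    proof (rule fps_rat_power_nth_low)
      fix i assume "i \<le> n"
      with n have i: "i < Suc j" by simp
      also have "Suc j \<le> m * Suc j" using mult_le_mono1[OF assms, of "Suc j"] by simp
      finally have i': "i < m * Suc j" .
      have "((1 - fps_X ^ a) * (1 - fps_X ^ b)) $ i = (1 :: rat fps) $ i"
        if "i < a" "i < b" for a b :: nat
        using that by (simp add: left_diff_distrib fps_X_power_mult_nth del: fps_one_nth)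
      from this[OF i i']
      show "((1 - fps_X ^ Suc j) * (1 - fps_X ^ (m * Suc j))) $ i = (1 :: rat fps) $ i" .
    qed (use n in simp)
  qed (rule fps_rat_power_nth_0)
  then show ?thesis unfolding euler_power_def by (simp only: has_prod_unique[symmetric])
qed

text \<open>The divisions in the arguments of \<open>p1\<close> are exact and the subtractions do not truncate.\<close>

lemma index_exact:
  assumes "s \<ge> (1 :: nat)"
  shows "8 dvd (7 * 3 ^ (2 * s - 1) - 5 :: nat)" "5 \<le> (7 * 3 ^ (2 * s - 1) :: nat)"
    and "8 dvd (7 * 5 ^ (2 * s - 1) - 3 :: nat)" "3 \<le> (7 * 5 ^ (2 * s - 1) :: nat)"
    and "2 dvd (5 ^ (2 * s - 1) - 1 :: nat)"
proof -
  obtain u where s: "2 * s - 1 = Suc (2 * u)"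
    using assms by (cases s) auto
  have "\<exists>v. (9 :: nat) ^ u = 8 * v + 1"
    by (induction u) (simp, simp, presburger)
  moreover have "\<exists>w. (25 :: nat) ^ u = 8 * w + 1"
    by (induction u) (simp, simp, presburger)
  ultimately obtain v w where "(9 :: nat) ^ u = 8 * v + 1" "(25 :: nat) ^ u = 8 * w + 1"
    by blast
  then have "(3 :: nat) ^ (2 * s - 1) = 24 * v + 3" "(5 :: nat) ^ (2 * s - 1) = 40 * w + 5"
    unfolding s power_Suc power_mult by simp_all
  then show "8 dvd (7 * 3 ^ (2 * s - 1) - 5 :: nat)" "5 \<le> (7 * 3 ^ (2 * s - 1) :: nat)"
    "8 dvd (7 * 5 ^ (2 * s - 1) - 3 :: nat)" "3 \<le> (7 * 5 ^ (2 * s - 1) :: nat)"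
    "2 dvd (5 ^ (2 * s - 1) - 1 :: nat)"
    by presburger+
qed

end

theory Submission
  imports Defs "HOL-Computational_Algebra.Polynomial"
begin

text \<open>
  Let \<open>f\<^sub>c = \<Prod>j\<ge>1. 1 - q\<^bsup>cj\<^esup>\<close>. With \<open>r\<close> equal to 5 or 3, the exponent is
  \<open>r - p\<^sup>k / b\<close>, so the series is \<open>F * H\<close> where \<open>F = (f\<^sub>1 f\<^sub>m)\<^sup>r\<close> and \<open>H\<close> is the
  \<open>- p\<^sup>k / b\<close>-th power. Taking the logarithmic derivative of \<open>H\<close> shows that \<open>p\<^sup>k\<close> divides
  \<open>i\<close> times its \<open>i\<close>-th coefficient.

  Index the coefficients of \<open>F\<close> by \<open>N = 8 n + \<beta>\<close>, \<open>\<beta> = r (1 + m) / 3\<close>. They satisfy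
  \<open>a (p\<^sup>2 N) = c a (N)\<close> with \<open>p\<^sup>2\<close> dividing \<open>c\<close>, and \<open>a (N) = 0\<close> if \<open>p\<close> divides \<open>N\<close> exactly
  once. Hence \<open>a (N)\<close> vanishes if the valuation of \<open>N\<close> is odd and is always divisible by the
  \<open>p\<close>-part of \<open>N\<close>, and every summand of the coefficient of \<open>F * H\<close> in question is divisible by
  \<open>p\<^sup>k\<close>.

  For \<open>r = 3\<close>, \<open>p = 5\<close> the two properties follow from Jacobi's formula for \<open>f\<^sub>1\<^sup>3\<close>, since
  \<open>x\<^sup>2 + m y\<^sup>2\<close> is anisotropic modulo 5 for \<open>m\<close> in \<open>{2, 3}\<close>. For \<open>r = 5\<close>, \<open>p = 3\<close> they follow
  from the 3-dissection \<open>f\<^sub>1 f\<^sub>2 = A - q B - 2 q\<^sup>2 C\<close> with \<open>A C = B\<^sup>2\<close> and \<open>B = f\<^sub>9 f\<^sub>1\<^sub>8\<close>: in its fifth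
  power, the exponents congruent to 2 modulo 3 contribute only \<open>- 81 q\<^sup>5 B\<^sup>5\<close>.
\<close>

section \<open>A finite triple product identity\<close>

text \<open>These are the Gaussian binomial coefficients in base \<open>p\<close>. Pascal's
  recursion avoids division, so they are available for polynomials and power series as well.\<close>

fun qbinomial :: "'a::comm_ring_1 \<Rightarrow> nat \<Rightarrow> nat \<Rightarrow> 'a" where
  "qbinomial p n 0 = 1"
| "qbinomial p 0 (Suc i) = 0"
| "qbinomial p (Suc n) (Suc i) = qbinomial p n i + p ^ Suc i * qbinomial p n (Suc i)"

lemma qbinomial_eq_0: "n < i \<Longrightarrow> qbinomial p n i = 0"
  by (induction p n i rule: qbinomial.induct) auto

lemma qbinomial_const_poly: "qbinomial [:p:] n i = [:qbinomial p n i:]"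
  by (induction p n i rule: qbinomial.induct) (simp_all add: poly_const_pow flip: one_pCons)

text \<open>The quotient formula for Gaussian binomials with denominators cleared. The induction
  rests on \<open>1 - p ^ (a + b) = (1 - p ^ a) + p ^ a * (1 - p ^ b)\<close> for
  \<open>a = Suc i\<close>, \<open>b = Suc d\<close>.\<close>

lemma qbinomial_mult_prods:
  fixes p :: "'a::comm_ring_1"
  assumes "i \<le> n"
  shows "qbinomial p n i * (\<Prod>j<i. 1 - p ^ Suc j) * (\<Prod>j<n-i. 1 - p ^ Suc j) = (\<Prod>j<n. 1 - p ^ Suc j)"
  using assms
proof (induction p n i rule: qbinomial.induct)
  case (3 p n i)
  let ?q = "\<lambda>n. \<Prod>j<n. 1 - p ^ Suc j"
  show ?case
  proof (cases "i = n")
    case True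
    have "qbinomial p n n * ?q n = ?q n" using 3(1) True by simp
    with True show ?thesis by (simp add: qbinomial_eq_0 mult.left_commute[of "qbinomial p n n"] mult.commute[of _ "1 - p * p ^ n"])
  next
    case False
    with 3 have le: "Suc i \<le> n" by simp
    then obtain d where d: "n = Suc i + d" using le_Suc_ex by blast
    have 1: "qbinomial p n i * ?q i * ?q (Suc d) = ?q n"
      using 3 le d by simp
    have 2: "qbinomial p n (Suc i) * ?q (Suc i) * ?q d = ?q n"
      using 3 le d by simp
    have "qbinomial p (Suc n) (Suc i) * ?q (Suc i) * ?q (Suc d)
        = (1 - p ^ Suc i) * (qbinomial p n i * ?q i * ?q (Suc d))
          + p ^ Suc i * (1 - p ^ Suc d) * (qbinomial p n (Suc i) * ?q (Suc i) * ?q d)"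
      by (simp add: algebra_simps)
    also have "\<dots> = (1 - p ^ Suc i * p ^ Suc d) * ?q n"
      unfolding 1 2 by (simp add: algebra_simps)
    also have "\<dots> = ?q (Suc n)"
      by (simp add: d power_add mult_ac)
    finally show ?thesis by (simp add: d)
  qed
qed simp_all

text \<open>Pascal's recursion is shifted onto the weights \<open>f\<close>, so that the product
  inductions below only have to compare single summands.\<close>

lemma sum_qbinomial_Suc:
  fixes p :: "'a::comm_ring_1"
  shows "(\<Sum>i\<le>Suc N. qbinomial p (Suc N) i * f i) =
         (\<Sum>i\<le>N. qbinomial p N i * (f (Suc i) + p ^ i * f i))"
proof -
  have "(\<Sum>i\<le>Suc N. qbinomial p (Suc N) i * f i) =
      f 0 + (\<Sum>i\<le>N. (qbinomial p N i + p ^ Suc i * qbinomial p N (Suc i)) * f (Suc i))"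
    by (subst sum.atMost_Suc_shift) simp
  also have "\<dots> = (\<Sum>i\<le>N. qbinomial p N i * f (Suc i))
      + (f 0 + (\<Sum>i\<le>N. qbinomial p N (Suc i) * (p ^ Suc i * f (Suc i))))"
    by (simp add: algebra_simps sum.distrib)
  also have "f 0 + (\<Sum>i\<le>N. qbinomial p N (Suc i) * (p ^ Suc i * f (Suc i)))
     = (\<Sum>i\<le>Suc N. qbinomial p N i * (p ^ i * f i))"
    by (subst sum.atMost_Suc_shift) simp
  also have "\<dots> = (\<Sum>i\<le>N. qbinomial p N i * (p ^ i * f i))"
    by (simp add: qbinomial_eq_0)
  finally show ?thesis by (simp add: algebra_simps sum.distrib)
qed

text \<open>Splitting off the factor \<open>j = 0\<close> leaves the same product with
  \<open>a * p\<close> in place of \<open>a\<close>, which is why the induction generalizes over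
  \<open>a\<close>.\<close>

lemma qbinomial_theorem:
  fixes p a :: "'a::comm_ring_1"
  shows "(\<Prod>j<m. 1 + a * p ^ j) = (\<Sum>i\<le>m. qbinomial p m i * (a ^ i * p ^ (i choose 2)))"
proof (induction m arbitrary: a)
  case (Suc m)
  have "(\<Prod>j<Suc m. 1 + a * p ^ j) = (1 + a) * (\<Prod>j<m. 1 + (a * p) * p ^ j)"
    by (subst prod.lessThan_Suc_shift) (simp add: mult_ac)
  also have "\<dots> = (\<Sum>i\<le>Suc m. qbinomial p (Suc m) i * (a ^ i * p ^ (i choose 2)))"
    unfolding Suc.IH sum_qbinomial_Suc sum_distrib_left
    by (intro sum.cong refl)
       (simp add: algebra_simps numeral_2_eq_2 power_add power_mult_distrib)
  finally show ?case .
qed (simp add: numeral_2_eq_2)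

text \<open>
  The \<open>i\<close>-th term is \<open>z\<^sup>n a\<^bsup>l(l+1)/2\<^esup> (b/z)\<^bsup>l(l-1)/2\<^esup>\<close> with \<open>l = i - n\<close>, rewritten by
  \<open>a b = z p\<close> so that no division occurs. For \<open>z = 1\<close> these are the terms of Ramanujan's theta
  series; the indeterminate \<open>z\<close> serves to differentiate at 1 in \<open>finite_jacobi\<close>.
\<close>

definition theta_term :: "'a::comm_ring_1 \<Rightarrow> 'a \<Rightarrow> 'a \<Rightarrow> 'a \<Rightarrow> nat \<Rightarrow> nat \<Rightarrow> 'a" where
  "theta_term a b z p n i =
     (if n \<le> i then a ^ (i - n) * p ^ ((i - n) choose 2) * z ^ n
      else b ^ (n - i) * p ^ ((n - i) choose 2) * z ^ i)"

text \<open>Induction on \<open>n\<close>, starting from the q-binomial theorem. Each new factor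
  \<open>z + b * p ^ n\<close> moves the centre of the sum by one, and Pascal's recursion reduces
  this to the comparison \<open>T\<close> of single terms.\<close>

lemma finite_triple_product:
  fixes p a b z :: "'a::comm_ring_1"
  assumes ab: "a * b = z * p"
  shows "(\<Prod>j<m. 1 + a * p ^ j) * (\<Prod>j<n. z + b * p ^ j) =
         (\<Sum>i\<le>m+n. qbinomial p (m + n) i * theta_term a b z p n i)"
proof (induction n)
  case 0
  show ?case by (simp add: qbinomial_theorem theta_term_def)
next
  case (Suc n)
  have T: "theta_term a b z p (Suc n) (Suc i) + p ^ i * theta_term a b z p (Suc n) i =
     theta_term a b z p n i * (z + b * p ^ n)" for i
  proof -
    have "theta_term a b z p (Suc n) (Suc i) = theta_term a b z p n i * z"
      by (simp add: theta_term_def)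
    moreover have "p ^ i * theta_term a b z p (Suc n) i = theta_term a b z p n i * (b * p ^ n)"
    proof (cases "Suc n \<le> i")
      \<comment> \<open>Right of the centre, the new \<open>b\<close> is paired with one
        \<open>a\<close> and replaced through \<open>a * b = z * p\<close>.\<close>
      case True
      then obtain d where d: "i = Suc n + d" using le_Suc_ex by blast
      have "theta_term a b z p n i * (b * p ^ n)
          = (a * b) * (a ^ d * p ^ ((Suc d choose 2) + n) * z ^ n)"
        by (simp add: theta_term_def d power_add mult_ac)
      also have "\<dots> = p ^ i * theta_term a b z p (Suc n) i"
        unfolding ab by (simp add: theta_term_def d power_add numeral_2_eq_2 mult_ac)
      finally show ?thesis ..
    next
      case False
      then obtain d where d: "n = i + d" by (metis le_Suc_ex not_less_eq_eq)
      show ?thesis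
        by (cases d) (simp_all add: theta_term_def d power_add numeral_2_eq_2 mult_ac)
    qed
    ultimately show ?thesis by (simp add: algebra_simps)
  qed
  have "(\<Prod>j<m. 1 + a * p ^ j) * (\<Prod>j<Suc n. z + b * p ^ j) =
    (\<Sum>i\<le>m+n. qbinomial p (m + n) i * theta_term a b z p n i) * (z + b * p ^ n)"
    by (simp add: Suc.IH flip: mult.assoc)
  also have "\<dots> = (\<Sum>i\<le>m + Suc n. qbinomial p (m + Suc n) i * theta_term a b z p (Suc n) i)"
    unfolding add_Suc_right sum_qbinomial_Suc T sum_distrib_right
    by (simp only: mult.assoc)
  finally show ?case .
qed

section \<open>Infinite products as formal power series\<close>

text \<open>Congruence modulo \<open>fps_X ^ Suc n\<close>. Identities of infinite products are
  proved on truncations, for every \<open>n\<close> separately.\<close>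

definition fps_agree :: "nat \<Rightarrow> 'a::zero fps \<Rightarrow> 'a fps \<Rightarrow> bool" where
  "fps_agree n f g \<longleftrightarrow> (\<forall>i\<le>n. f $ i = g $ i)"

lemma fps_agreeD: "fps_agree n f g \<Longrightarrow> i \<le> n \<Longrightarrow> f $ i = g $ i"
  by (simp add: fps_agree_def)

lemma fps_eqI_agree: "(\<And>n. fps_agree n f g) \<Longrightarrow> f = g"
  by (auto simp: fps_agree_def fps_eq_iff)

lemma fps_agree_refl [simp]: "fps_agree n f f"
  by (simp add: fps_agree_def)

lemma fps_agree_sym: "fps_agree n f g \<Longrightarrow> fps_agree n g f"
  by (simp add: fps_agree_def)

lemma fps_agree_trans [trans]: "fps_agree n f g \<Longrightarrow> fps_agree n g h \<Longrightarrow> fps_agree n f h"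
  by (simp add: fps_agree_def)

lemma fps_agree_mult:
  fixes f g :: "'a::comm_ring_1 fps"
  shows "fps_agree n f f' \<Longrightarrow> fps_agree n g g' \<Longrightarrow> fps_agree n (f * g) (f' * g')"
  by (auto simp: fps_agree_def fps_mult_nth intro!: sum.cong)

lemma fps_agree_sum:
  fixes f g :: "'b \<Rightarrow> 'a::comm_ring_1 fps"
  shows "(\<And>i. i \<in> A \<Longrightarrow> fps_agree n (f i) (g i)) \<Longrightarrow> fps_agree n (sum f A) (sum g A)"
  by (simp add: fps_agree_def fps_sum_nth)

lemma fps_agree_prod_1:
  fixes f :: "'b \<Rightarrow> 'a::comm_ring_1 fps"
  assumes "\<And>i. i \<in> A \<Longrightarrow> fps_agree n (f i) 1"
  shows "fps_agree n (prod f A) 1"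
  using assms
proof (induction A rule: infinite_finite_induct)
  case (insert x A)
  then have "fps_agree n (f x * prod f A) (1 * 1)"
    by (intro fps_agree_mult) auto
  with insert show ?case by simp
qed simp_all

text \<open>The infinite product of \<open>1 + s X^(a + c j)\<close> over \<open>j >= 0\<close>. For
  \<open>c > 0\<close> the factors with \<open>j > n\<close> do not affect the coefficient at
  \<open>n\<close>, so a finite product determines it. With \<open>a = 0\<close> the first factor is
  the constant \<open>1 + s\<close>.\<close>

definition qprod :: "rat \<Rightarrow> nat \<Rightarrow> nat \<Rightarrow> rat fps" where
  "qprod s a c = Abs_fps (\<lambda>n. (\<Prod>j\<le>n. 1 + fps_const s * fps_X ^ (a + c * j)) $ n)"

lemma qprod_agree:
  assumes "c > 0" "n < M"
  shows "fps_agree n (qprod s a c) (\<Prod>j<M. 1 + fps_const s * fps_X ^ (a + c * j))"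
  unfolding fps_agree_def
proof safe
  fix i assume i: "i \<le> n"
  let ?f = "\<lambda>j. 1 + fps_const s * fps_X ^ (a + c * j)"
  have "fps_agree i (?f j) 1" if "i < j" for j
  proof -
    have "j \<le> c * j" using assms by simp
    then have "j \<le> a + c * j" by linarith
    with that show ?thesis by (auto simp: fps_agree_def fps_X_power_mult_right_nth)
  qed
  then have "fps_agree i (prod ?f {Suc i..<M}) 1"
    by (intro fps_agree_prod_1) auto
  then have "fps_agree i (prod ?f {..i} * prod ?f {Suc i..<M}) (prod ?f {..i} * 1)"
    by (intro fps_agree_mult) auto
  also have "prod ?f {..i} * prod ?f {Suc i..<M} = prod ?f {..<M}"
    using i assms by (subst prod.union_disjoint [symmetric]) (auto intro!: prod.cong)
  finally show "qprod s a c $ i = prod ?f {..<M} $ i"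
    by (simp add: fps_agree_def qprod_def)
qed

lemma qprod_nth_0: "a > 0 \<Longrightarrow> c > 0 \<Longrightarrow> qprod s a c $ 0 = 1"
  using qprod_agree[of c 0 1 s a] by (simp add: fps_agree_def)

lemma qprod_nonzero: "a > 0 \<Longrightarrow> c > 0 \<Longrightarrow> qprod s a c \<noteq> 0"
  using qprod_nth_0[of a c s] by auto

lemma qprod_split2:
  assumes "c > 0"
  shows "qprod s a (2 * c) * qprod s (a + c) (2 * c) = qprod s a c"
proof (rule fps_eqI_agree)
  fix n
  let ?f = "\<lambda>j. 1 + fps_const s * fps_X ^ (a + c * j)"
  define M where "M = Suc n"
  have "fps_agree n (qprod s a (2 * c) * qprod s (a + c) (2 * c))
    ((\<Prod>j<M. 1 + fps_const s * fps_X ^ (a + 2 * c * j)) * (\<Prod>j<M. 1 + fps_const s * fps_X ^ (a + c + 2 * c * j)))"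
    by (intro fps_agree_mult qprod_agree) (use assms in \<open>auto simp: M_def\<close>)
  also have "\<dots> = prod ?f {..<2*M}"
    by (induction M) (simp_all add: algebra_simps)
  also have "fps_agree n \<dots> (qprod s a c)"
    by (rule fps_agree_sym, rule qprod_agree) (use assms in \<open>auto simp: M_def\<close>)
  finally show "fps_agree n (qprod s a (2 * c) * qprod s (a + c) (2 * c)) (qprod s a c)" .
qed

lemma qprod_split3:
  assumes "c > 0"
  shows "qprod s a (3 * c) * qprod s (a + c) (3 * c) * qprod s (a + 2 * c) (3 * c) = qprod s a c"
proof (rule fps_eqI_agree)
  fix n
  let ?f = "\<lambda>j. 1 + fps_const s * fps_X ^ (a + c * j)"
  define M where "M = Suc n"
  have "fps_agree n (qprod s a (3 * c) * qprod s (a + c) (3 * c) * qprod s (a + 2 * c) (3 * c))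
    ((\<Prod>j<M. 1 + fps_const s * fps_X ^ (a + 3 * c * j)) * (\<Prod>j<M. 1 + fps_const s * fps_X ^ (a + c + 3 * c * j))
      * (\<Prod>j<M. 1 + fps_const s * fps_X ^ (a + 2 * c + 3 * c * j)))"
    by (intro fps_agree_mult qprod_agree) (use assms in \<open>auto simp: M_def\<close>)
  also have "\<dots> = prod ?f {..<3*M}"
  proof (induction M)
    case (Suc M)
    have "3 * Suc M = Suc (Suc (Suc (3 * M)))" by simp
    then have "prod ?f {..<3*Suc M} = prod ?f {..<3*M} * ?f (3*M) * ?f (3*M+1) * ?f (3*M+2)"
      by (simp only: prod.lessThan_Suc) simp
    also have "?f (3 * M) = 1 + fps_const s * fps_X ^ (a + 3 * c * M)"
      by (simp add: mult_ac)
    also have "?f (3 * M + 1) = 1 + fps_const s * fps_X ^ (a + c + 3 * c * M)"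
      by (simp add: algebra_simps)
    also have "?f (3 * M + 2) = 1 + fps_const s * fps_X ^ (a + 2 * c + 3 * c * M)"
      by (simp add: algebra_simps)
    finally show ?case by (simp only: prod.lessThan_Suc flip: Suc.IH) (simp only: mult_ac)
  qed simp
  also have "fps_agree n \<dots> (qprod s a c)"
    by (rule fps_agree_sym, rule qprod_agree) (use assms in \<open>auto simp: M_def\<close>)
  finally show "fps_agree n (qprod s a (3 * c) * qprod s (a + c) (3 * c) * qprod s (a + 2 * c) (3 * c)) (qprod s a c)" .
qed

lemma qprod_mult_minus:
  assumes "c > 0"
  shows "qprod 1 a c * qprod (-1) a c = qprod (-1) (2 * a) (2 * c)"
proof (rule fps_eqI_agree)
  fix n
  define M where "M = Suc n"
  have "fps_agree n (qprod 1 a c * qprod (-1) a c)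
    ((\<Prod>j<M. 1 + fps_const 1 * fps_X ^ (a + c * j)) * (\<Prod>j<M. 1 + fps_const (-1) * fps_X ^ (a + c * j)))"
    by (intro fps_agree_mult qprod_agree) (use assms in \<open>auto simp: M_def\<close>)
  also have "\<dots> = (\<Prod>j<M. 1 + fps_const (-1) * fps_X ^ (2 * a + 2 * c * j))"
    unfolding prod.distrib [symmetric]
    by (intro prod.cong refl) (simp add: algebra_simps power_mult_distrib flip: power_add fps_const_neg)
  also have "fps_agree n \<dots> (qprod (-1) (2 * a) (2 * c))"
    by (rule fps_agree_sym, rule qprod_agree) (use assms in \<open>auto simp: M_def\<close>)
  finally show "fps_agree n (qprod 1 a c * qprod (-1) a c) (qprod (-1) (2 * a) (2 * c))" .
qed

abbreviation euler :: "nat \<Rightarrow> rat fps" where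
  "euler c \<equiv> qprod (-1) c c"

lemma euler_agree:
  assumes "c > 0" "n < M"
  shows "fps_agree n (euler c) (\<Prod>j<M. 1 - (fps_X ^ c) ^ Suc j)"
proof -
  have "(\<Prod>j<M. 1 - (fps_X ^ c) ^ Suc j) = (\<Prod>j<M. 1 + fps_const (-1) * fps_X ^ (c + c * j) :: rat fps)"
    by (intro prod.cong refl) (simp add: power_add flip: power_mult fps_const_neg)
  then show ?thesis using qprod_agree[OF assms] by simp
qed

lemma fps_agree_cancel:
  fixes E :: "rat fps"
  assumes "E $ 0 = 1" "fps_agree n (f * E) (g * E)"
  shows "fps_agree n f g"
proof -
  have "fps_agree n ((f * E) * inverse E) ((g * E) * inverse E)"
    by (rule fps_agree_mult[OF assms(2) fps_agree_refl])
  moreover have "E * inverse E = 1" using assms by (simp add: inverse_mult_eq_1')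
  ultimately show ?thesis by (simp only: mult.assoc mult_1_right)
qed

text \<open>In the quotient formula all three finite products agree with \<open>euler c\<close> up
  to degree \<open>n\<close>, since \<open>i\<close>, \<open>N - i\<close> and \<open>N\<close>
  exceed \<open>n\<close>. One of the two factors \<open>euler c\<close> then cancels.\<close>

lemma euler_qbinomial_agree:
  assumes "c > 0" "n < i" "n < N - i" "i \<le> N"
  shows "fps_agree n (euler c * qbinomial (fps_X ^ c) N i) 1"
proof (rule fps_agree_cancel)
  show "euler c $ 0 = 1" using assms by (simp add: qprod_nth_0)
  let ?q = "\<lambda>N. \<Prod>j<N. 1 - (fps_X ^ c) ^ Suc j :: rat fps"
  have "fps_agree n (qbinomial (fps_X ^ c) N i * euler c * euler c) (qbinomial (fps_X ^ c) N i * ?q i * ?q (N - i))"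
    by (intro fps_agree_mult euler_agree) (use assms in auto)
  also have "\<dots> = ?q N" using assms by (intro qbinomial_mult_prods)
  also have "fps_agree n \<dots> (euler c)"
    by (intro fps_agree_sym[OF euler_agree]) (use assms in auto)
  finally show "fps_agree n (euler c * qbinomial (fps_X ^ c) N i * euler c) (1 * euler c)"
    by (simp add: mult_ac)
qed

text \<open>The passage to the limit in both finite identities: away from the two ends the Gaussian
  binomial is the inverse of \<open>euler c\<close> up to degree \<open>n\<close>, and near the ends
  the terms themselves have no coefficients up to degree \<open>n\<close>.\<close>

lemma euler_qbinomial_sum_agree:
  assumes c: "c > 0"
    and small: "\<And>i. i \<le> N \<Longrightarrow> i \<le> n \<or> N - i \<le> n \<Longrightarrow> fps_agree n (T i) 0"
  shows "fps_agree n (euler c * (\<Sum>i\<le>N. qbinomial (fps_X ^ c) N i * T i)) (\<Sum>i\<le>N. T i)"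
  unfolding sum_distrib_left
proof (rule fps_agree_sum)
  fix i assume i: "i \<in> {..N}"
  show "fps_agree n (euler c * (qbinomial (fps_X ^ c) N i * T i)) (T i)"
  proof (cases "i \<le> n \<or> N - i \<le> n")
    case True
    then have T: "fps_agree n (T i) 0" using small i by simp
    have "fps_agree n (euler c * qbinomial (fps_X ^ c) N i * T i)
      (euler c * qbinomial (fps_X ^ c) N i * 0)"
      by (intro fps_agree_mult T fps_agree_refl)
    also have "\<dots> = 0" by simp
    also have "fps_agree n 0 (T i)" using T by (rule fps_agree_sym)
    finally show ?thesis by (simp add: mult.assoc)
  next
    case False
    with i c have "fps_agree n (euler c * qbinomial (fps_X ^ c) N i * T i) (1 * T i)"
      by (intro fps_agree_mult euler_qbinomial_agree) auto
    then show ?thesis by (simp add: mult.assoc)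
  qed
qed

section \<open>The triple product identity\<close>

text \<open>Twice the exponent of the \<open>k\<close>-th term of the theta series.\<close>

definition theta_exp :: "nat \<Rightarrow> nat \<Rightarrow> int \<Rightarrow> int" where
  "theta_exp \<alpha> \<beta> k = int \<alpha> * (k * (k + 1)) + int \<beta> * (k * (k - 1))"

text \<open>Ramanujan's theta function f(a, b) with \<open>a = s X^\<alpha>\<close> and
  \<open>b = s X^\<beta>\<close>, for \<open>s\<close> equal to 1 or -1. The sign of the term at
  \<open>k\<close> is \<open>s\<close> to the power \<open>k * k\<close>, which is then
  \<open>s powi k\<close>.\<close>

definition theta :: "rat \<Rightarrow> nat \<Rightarrow> nat \<Rightarrow> rat fps" where
  "theta s \<alpha> \<beta> = Abs_fps (\<lambda>n. \<Sum>k | theta_exp \<alpha> \<beta> k = 2 * int n. s powi k)"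

text \<open>For an integer \<open>k\<close>,
  \<open>(\<bar>k\<bar> - 1) * (\<bar>k\<bar> - 2) \<ge> 0\<close>, which bounds both products
  \<open>k * (k + 1)\<close> and \<open>k * (k - 1)\<close> from below. The linear bound makes the
  defining sums of \<open>theta\<close> finite and localizes their indices.\<close>

lemma theta_exp_ge:
  assumes "\<alpha> + \<beta> > 0"
  shows "theta_exp \<alpha> \<beta> k \<ge> 2 * (\<bar>k\<bar> - 1)"
proof -
  have nn: "k * (k + 1) \<ge> 0" "k * (k - 1) \<ge> 0"
    by (cases "k \<ge> 0"; simp add: zero_le_mult_iff)
       (cases "k \<ge> 1"; auto simp add: zero_le_mult_iff)
  have ge: "k * (k + 1) \<ge> 2 * (\<bar>k\<bar> - 1)" "k * (k - 1) \<ge> 2 * (\<bar>k\<bar> - 1)"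
  proof -
    have "(\<bar>k\<bar> - 1) * (\<bar>k\<bar> - 2) \<ge> 0"
      by (cases "\<bar>k\<bar> \<ge> 2") (auto simp: zero_le_mult_iff)
    moreover have "\<bar>k\<bar> * \<bar>k\<bar> = k * k" by simp
    ultimately have "k * k - 3 * \<bar>k\<bar> + 2 \<ge> 0" by (simp add: algebra_simps)
    then show "k * (k + 1) \<ge> 2 * (\<bar>k\<bar> - 1)" "k * (k - 1) \<ge> 2 * (\<bar>k\<bar> - 1)"
      by (auto simp: algebra_simps)
  qed
  consider "\<alpha> \<ge> 1" | "\<beta> \<ge> 1" using assms by linarith
  then show ?thesis
  proof cases
    case 1
    then have "1 * (k * (k + 1)) \<le> int \<alpha> * (k * (k + 1))" using nn by (intro mult_right_mono) auto
    moreover have "0 \<le> int \<beta> * (k * (k - 1))" using nn by simp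
    ultimately show ?thesis using ge unfolding theta_exp_def by linarith
  next
    case 2
    then have "1 * (k * (k - 1)) \<le> int \<beta> * (k * (k - 1))" using nn by (intro mult_right_mono) auto
    moreover have "0 \<le> int \<alpha> * (k * (k + 1))" using nn by simp
    ultimately show ?thesis using ge unfolding theta_exp_def by linarith
  qed
qed

lemma theta_exp_eq_imp:
  assumes "\<alpha> + \<beta> > 0" "theta_exp \<alpha> \<beta> k = 2 * int n"
  shows "\<bar>k\<bar> \<le> int n + 1"
proof -
  have "2 * (\<bar>k\<bar> - 1) \<le> 2 * int n"
    using theta_exp_ge[OF assms(1), of k] unfolding assms(2) .
  then show ?thesis by simp
qed

lemma finite_theta_exp:
  assumes "\<alpha> + \<beta> > 0"
  shows "finite {k. theta_exp \<alpha> \<beta> k = 2 * int n}"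
  by (rule finite_subset[of _ "{- (int n + 1)..int n + 1}"])
     (use theta_exp_eq_imp[OF assms] in \<open>fastforce+\<close>)

lemma int_choose_2: "2 * int (d choose 2) = int d * (int d - 1)"
  by (induction d) (simp_all add: numeral_2_eq_2 algebra_simps)

lemma power_int_unit_square:
  fixes s :: rat
  assumes "s * s = 1"
  shows "s powi (- int d) = s ^ d"
proof -
  have "inverse s = s" using assms by (metis inverse_unique)
  then show ?thesis by (simp add: power_int_minus flip: power_inverse)
qed

text \<open>At \<open>z = 1\<close> the term with index \<open>i\<close> is the monomial of the
  theta series with index \<open>k = i - M\<close>. Left of the centre, \<open>s * s = 1\<close>
  lets the negative power of \<open>s\<close> be replaced by a positive one.\<close>

lemma theta_term_nth:
  fixes s :: rat
  assumes "s * s = 1"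
  shows "theta_term (fps_const s * fps_X ^ \<alpha>) (fps_const s * fps_X ^ \<beta>) 1 (fps_X ^ (\<alpha> + \<beta>)) M i $ r
       = (if theta_exp \<alpha> \<beta> (int i - int M) = 2 * int r then s powi (int i - int M) else 0)"
proof (cases "M \<le> i")
  case True
  then obtain d where d: "i = M + d" using le_Suc_ex by blast
  have "theta_exp \<alpha> \<beta> (int d) = 2 * int (\<alpha> * d + (\<alpha> + \<beta>) * (d choose 2))"
  proof -
    have "2 * int (\<alpha> * d + (\<alpha> + \<beta>) * (d choose 2)) = 2 * int \<alpha> * int d + int (\<alpha> + \<beta>) * (2 * int (d choose 2))"
      by (simp add: algebra_simps)
    then show ?thesis unfolding int_choose_2 by (simp add: theta_exp_def algebra_simps)
  qed
  then have "theta_exp \<alpha> \<beta> (int d) = 2 * int r \<longleftrightarrow> r = \<alpha> * d + (\<alpha> + \<beta>) * (d choose 2)"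
    by (simp only: mult_cancel_left of_nat_eq_iff) auto
  then show ?thesis
    by (simp add: theta_term_def d power_mult_distrib fps_const_power mult.assoc
        flip: power_mult power_add)
next
  case False
  then obtain d where d: "M = i + d" by (metis le_Suc_ex nat_le_linear)
  have "theta_exp \<alpha> \<beta> (- int d) = 2 * int (\<beta> * d + (\<alpha> + \<beta>) * (d choose 2))"
  proof -
    have "2 * int (\<beta> * d + (\<alpha> + \<beta>) * (d choose 2)) = 2 * int \<beta> * int d + int (\<alpha> + \<beta>) * (2 * int (d choose 2))"
      by (simp add: algebra_simps)
    then show ?thesis unfolding int_choose_2 by (simp add: theta_exp_def algebra_simps)
  qed
  then have "theta_exp \<alpha> \<beta> (- int d) = 2 * int r \<longleftrightarrow> r = \<beta> * d + (\<alpha> + \<beta>) * (d choose 2)"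
    by (simp only: mult_cancel_left of_nat_eq_iff) auto
  then show ?thesis using False
    by (simp add: theta_term_def d power_mult_distrib fps_const_power mult.assoc power_int_unit_square[OF assms]
        flip: power_mult power_add)
qed

text \<open>The finite identity with \<open>M\<close> factors in each product is multiplied by
  \<open>euler (\<alpha> + \<beta>)\<close>, which cancels the Gaussian binomials up to degree
  \<open>n\<close>.\<close>

theorem triple_product:
  assumes s: "s * s = 1" and c: "\<alpha> + \<beta> > 0"
  shows "theta s \<alpha> \<beta> = qprod s \<alpha> (\<alpha> + \<beta>) * qprod s \<beta> (\<alpha> + \<beta>) * euler (\<alpha> + \<beta>)"
proof (rule fps_eqI_agree)
  fix n :: nat
  \<comment> \<open>Terms of degree at most \<open>n\<close> have
    \<open>\<bar>k\<bar> \<le> n + 1\<close>, whereas indices within \<open>n\<close> of either end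
    of the sum have \<open>\<bar>k\<bar> \<ge> n + 2\<close>.\<close>
  define M where "M = 2 * n + 2"
  define a where "a = fps_const s * fps_X ^ \<alpha>"
  define b where "b = fps_const s * fps_X ^ \<beta>"
  define p :: "rat fps" where "p = fps_X ^ (\<alpha> + \<beta>)"
  define T where "T = theta_term a b 1 p M"
  have T_nth: "T i $ r = (if theta_exp \<alpha> \<beta> (int i - int M) = 2 * int r then s powi (int i - int M) else 0)" for i r
    unfolding T_def a_def b_def p_def by (rule theta_term_nth[OF s])
  have ab: "a * b = 1 * p"
  proof -
    have "a * b = (fps_const s * fps_const s) * (fps_X ^ \<alpha> * fps_X ^ \<beta>)"
      by (simp only: a_def b_def mult_ac)
    then show ?thesis using s by (simp add: p_def power_add)
  qed
  have "fps_agree n (theta s \<alpha> \<beta>) (\<Sum>i\<le>M+M. T i)"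
    unfolding fps_agree_def
  proof safe
    fix r assume r: "r \<le> n"
    have "(\<Sum>i\<le>M+M. T i) $ r = (\<Sum>i | i \<le> M+M \<and> theta_exp \<alpha> \<beta> (int i - int M) = 2 * int r. s powi (int i - int M))"
      by (simp add: fps_sum_nth T_nth sum.If_cases Int_def conj_commute)
    also have "\<dots> = (\<Sum>k | theta_exp \<alpha> \<beta> k = 2 * int r. s powi k)"
    proof (rule sum.reindex_bij_witness[of _ "\<lambda>k. nat (k + int M)" "\<lambda>i. int i - int M"])
      fix k assume "k \<in> {k. theta_exp \<alpha> \<beta> k = 2 * int r}"
      then have "theta_exp \<alpha> \<beta> k = 2 * int r" "\<bar>k\<bar> \<le> int r + 1"
        using theta_exp_eq_imp[OF c] by auto
      then show "int (nat (k + int M)) - int M = k"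
         "nat (k + int M) \<in> {i. i \<le> M+M \<and> theta_exp \<alpha> \<beta> (int i - int M) = 2 * int r}"
        using r by (auto simp: M_def)
    qed auto
    finally show "theta s \<alpha> \<beta> $ r = (\<Sum>i\<le>M+M. T i) $ r"
      by (simp add: theta_def)
  qed
  also have "fps_agree n \<dots> (euler (\<alpha> + \<beta>) * (\<Sum>i\<le>M+M. qbinomial p (M + M) i * T i))"
    unfolding p_def
  proof (intro fps_agree_sym[OF euler_qbinomial_sum_agree] c)
    fix i assume i: "i \<le> M + M" "i \<le> n \<or> M + M - i \<le> n"
    show "fps_agree n (T i) 0"
      unfolding fps_agree_def T_nth
    proof safe
      fix r assume "r \<le> n"
      with i theta_exp_eq_imp[OF c, of "int i - int M" r]
      have "theta_exp \<alpha> \<beta> (int i - int M) \<noteq> 2 * int r"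
        by (auto simp: M_def)
      then show "(if theta_exp \<alpha> \<beta> (int i - int M) = 2 * int r then s powi (int i - int M) else 0) = 0 $ r"
        by simp
    qed
  qed
  also have "\<dots> = euler (\<alpha> + \<beta>) * ((\<Prod>j<M. 1 + a * p ^ j) * (\<Prod>j<M. 1 + b * p ^ j))"
    unfolding T_def by (simp only: finite_triple_product[OF ab])
  also have "\<dots> = (\<Prod>j<M. 1 + fps_const s * fps_X ^ (\<alpha> + (\<alpha> + \<beta>) * j)) *
      (\<Prod>j<M. 1 + fps_const s * fps_X ^ (\<beta> + (\<alpha> + \<beta>) * j)) * euler (\<alpha> + \<beta>)"
  proof -
    have "a * p ^ j = fps_const s * fps_X ^ (\<alpha> + (\<alpha> + \<beta>) * j)"
      "b * p ^ j = fps_const s * fps_X ^ (\<beta> + (\<alpha> + \<beta>) * j)" for j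
      by (simp_all only: a_def b_def p_def power_add [of fps_X \<alpha>] power_add [of fps_X \<beta>] mult.assoc
          flip: power_mult)
         (simp_all only: power_add power_mult mult.assoc)
    then show ?thesis by (simp only: mult_ac)
  qed
  also have "fps_agree n \<dots> (qprod s \<alpha> (\<alpha> + \<beta>) * qprod s \<beta> (\<alpha> + \<beta>) * euler (\<alpha> + \<beta>))"
    by (rule fps_agree_sym) (intro fps_agree_mult qprod_agree c fps_agree_refl; simp add: M_def)
  finally show "fps_agree n (theta s \<alpha> \<beta>) (qprod s \<alpha> (\<alpha> + \<beta>) * qprod s \<beta> (\<alpha> + \<beta>) * euler (\<alpha> + \<beta>))" .
qed

lemma theta_commute: "s * s = 1 \<Longrightarrow> \<alpha> + \<beta> > 0 \<Longrightarrow> theta s \<alpha> \<beta> = theta s \<beta> \<alpha>"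
  by (simp add: triple_product add.commute mult_ac)

lemma fps_X_power_mult_theta_nth:
  assumes "\<alpha> + \<beta> > 0"
  shows "(fps_X ^ a * theta s \<alpha> \<beta>) $ n = (\<Sum>k | theta_exp \<alpha> \<beta> k + 2 * int a = 2 * int n. s powi k)"
proof (cases "a \<le> n")
  case True
  then have "theta_exp \<alpha> \<beta> k + 2 * int a = 2 * int n \<longleftrightarrow> theta_exp \<alpha> \<beta> k = 2 * int (n - a)" for k
    by auto
  with True show ?thesis by (simp add: fps_X_power_mult_nth theta_def)
next
  case False
  have "theta_exp \<alpha> \<beta> k \<ge> 0" for k
    using theta_exp_ge[OF assms, of k] by (cases "k = 0") (auto simp: theta_exp_def)
  then have "theta_exp \<alpha> \<beta> k + 2 * int a \<noteq> 2 * int n" for k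
    using False by (smt (verit) of_nat_less_iff not_less)
  with False show ?thesis by (simp add: fps_X_power_mult_nth)
qed

text \<open>The index is split as \<open>3 * l\<close>, \<open>3 * l + 1\<close>,
  \<open>3 * l - 1\<close>; on each class the exponents again have theta form up to a shift. Since
  the cube of \<open>s\<close> is \<open>s\<close>, the signs remain those of a theta
  series.\<close>

lemma theta_dissection_3:
  assumes s: "s * s = 1" and c: "\<alpha> + \<beta> > 0"
  shows "theta s \<alpha> \<beta> = theta s (6 * \<alpha> + 3 * \<beta>) (3 * \<alpha> + 6 * \<beta>)
     + fps_const s * (fps_X ^ \<alpha> * theta s (9 * \<alpha> + 6 * \<beta>) (3 * \<beta>))
     + fps_const s * (fps_X ^ \<beta> * theta s (3 * \<alpha>) (6 * \<alpha> + 9 * \<beta>))"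
proof (rule fps_ext)
  fix n
  let ?K = "{k. theta_exp \<alpha> \<beta> k = 2 * int n}"
  let ?Ka = "{l. theta_exp (6 * \<alpha> + 3 * \<beta>) (3 * \<alpha> + 6 * \<beta>) l = 2 * int n}"
  let ?Kb = "{l. theta_exp (9 * \<alpha> + 6 * \<beta>) (3 * \<beta>) l + 2 * int \<alpha> = 2 * int n}"
  let ?Kc = "{l. theta_exp (3 * \<alpha>) (6 * \<alpha> + 9 * \<beta>) l + 2 * int \<beta> = 2 * int n}"
  have s0: "s \<noteq> 0" using s by auto
  have s3: "s powi (3 * l) = s powi l" for l
    by (subst power_int_mult) (simp add: s power3_eq_cube)
  have e0: "theta_exp \<alpha> \<beta> (3 * l) = theta_exp (6 * \<alpha> + 3 * \<beta>) (3 * \<alpha> + 6 * \<beta>) l" for l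
    by (simp add: theta_exp_def algebra_simps)
  have e1: "theta_exp \<alpha> \<beta> (3 * l + 1) = theta_exp (9 * \<alpha> + 6 * \<beta>) (3 * \<beta>) l + 2 * int \<alpha>" for l
    by (simp add: theta_exp_def algebra_simps)
  have e2: "theta_exp \<alpha> \<beta> (3 * l - 1) = theta_exp (3 * \<alpha>) (6 * \<alpha> + 9 * \<beta>) l + 2 * int \<beta>" for l
    by (simp add: theta_exp_def algebra_simps)
  have fin: "finite ?K" by (rule finite_theta_exp[OF c])
  have K: "?K = (\<lambda>l. 3 * l) ` ?Ka \<union> ((\<lambda>l. 3 * l + 1) ` ?Kb \<union> (\<lambda>l. 3 * l - 1) ` ?Kc)"
  proof (intro equalityI subsetI)
    fix k assume k: "k \<in> ?K"
    consider l where "k = 3 * l" | l where "k = 3 * l + 1" | l where "k = 3 * l - 1"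
    proof -
      have "k = 3 * (k div 3) \<or> k = 3 * (k div 3) + 1 \<or> k = 3 * (k div 3 + 1) - 1"
        by presburger
      then show thesis using that by blast
    qed
    then show "k \<in> (\<lambda>l. 3 * l) ` ?Ka \<union> ((\<lambda>l. 3 * l + 1) ` ?Kb \<union> (\<lambda>l. 3 * l - 1) ` ?Kc)"
      using k by cases (auto simp: e0 e1 e2)
  qed (auto simp: e0 e1 e2)
  have "finite ((\<lambda>l. 3 * l) ` ?Ka)" "finite ((\<lambda>l. 3 * l + 1) ` ?Kb)" "finite ((\<lambda>l. 3 * l - 1) ` ?Kc)"
    using fin unfolding K by (simp_all only: finite_Un)
  moreover have "(\<lambda>l. 3 * l) ` ?Ka \<inter> ((\<lambda>l. 3 * l + 1) ` ?Kb \<union> (\<lambda>l. 3 * l - 1) ` ?Kc) = {}"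
     "(\<lambda>l. 3 * l + 1) ` ?Kb \<inter> (\<lambda>l. 3 * l - 1) ` ?Kc = {}"
  proof -
    have "3 * l \<noteq> 3 * m + 1" "3 * l \<noteq> 3 * m - 1" "3 * l + 1 \<noteq> 3 * m - 1" for l m :: int
      by presburger+
    then show "(\<lambda>l. 3 * l) ` ?Ka \<inter> ((\<lambda>l. 3 * l + 1) ` ?Kb \<union> (\<lambda>l. 3 * l - 1) ` ?Kc) = {}"
     "(\<lambda>l. 3 * l + 1) ` ?Kb \<inter> (\<lambda>l. 3 * l - 1) ` ?Kc = {}"
      by blast+
  qed
  ultimately have "(\<Sum>k\<in>?K. s powi k) = (\<Sum>k\<in>(\<lambda>l. 3 * l) ` ?Ka. s powi k) +
     ((\<Sum>k\<in>(\<lambda>l. 3 * l + 1) ` ?Kb. s powi k) + (\<Sum>k\<in>(\<lambda>l. 3 * l - 1) ` ?Kc. s powi k))"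
    unfolding K by (simp only: sum.union_disjoint finite_Un simp_thms)
  also have "(\<Sum>k\<in>(\<lambda>l. 3 * l) ` ?Ka. s powi k) = (\<Sum>l\<in>?Ka. s powi l)"
    by (subst sum.reindex) (auto simp: inj_on_def s3)
  also have "(\<Sum>k\<in>(\<lambda>l. 3 * l + 1) ` ?Kb. s powi k) = s * (\<Sum>l\<in>?Kb. s powi l)"
    by (subst sum.reindex) (auto simp: inj_on_def s3 power_int_add s0 sum_distrib_left mult.commute[of _ s])
  also have "(\<Sum>k\<in>(\<lambda>l. 3 * l - 1) ` ?Kc. s powi k) = s * (\<Sum>l\<in>?Kc. s powi l)"
  proof -
    have "inverse s = s" using s by (metis inverse_unique)
    then show ?thesis
      by (subst sum.reindex) (auto simp: inj_on_def s3 power_int_diff s0 sum_distrib_left divide_inverse mult.commute[of _ s])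
  qed
  finally have "(\<Sum>k\<in>?K. s powi k) = (\<Sum>l\<in>?Ka. s powi l) + (s * (\<Sum>l\<in>?Kb. s powi l) + s * (\<Sum>l\<in>?Kc. s powi l))" .
  moreover have "(\<Sum>k\<in>?K. s powi k) = theta s \<alpha> \<beta> $ n" "(\<Sum>l\<in>?Ka. s powi l) = theta s (6 * \<alpha> + 3 * \<beta>) (3 * \<alpha> + 6 * \<beta>) $ n"
    by (simp_all add: theta_def)
  moreover have "(\<Sum>l\<in>?Kb. s powi l) = (fps_X ^ \<alpha> * theta s (9 * \<alpha> + 6 * \<beta>) (3 * \<beta>)) $ n"
    using c by (subst fps_X_power_mult_theta_nth) auto
  moreover have "(\<Sum>l\<in>?Kc. s powi l) = (fps_X ^ \<beta> * theta s (3 * \<alpha>) (6 * \<alpha> + 9 * \<beta>)) $ n"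
    using c by (subst fps_X_power_mult_theta_nth) auto
  ultimately show "theta s \<alpha> \<beta> $ n = (theta s (6 * \<alpha> + 3 * \<beta>) (3 * \<alpha> + 6 * \<beta>)
     + fps_const s * (fps_X ^ \<alpha> * theta s (9 * \<alpha> + 6 * \<beta>) (3 * \<beta>))
     + fps_const s * (fps_X ^ \<beta> * theta s (3 * \<alpha>) (6 * \<alpha> + 9 * \<beta>))) $ n"
    by simp
qed

section \<open>Jacobi's identity for the cube of the Euler product\<close>

lemma Suc_choose_2: "2 * (Suc k choose 2) = k * Suc k"
  by (induction k) (simp_all add: numeral_2_eq_2)

lemma finite_triangular: "finite {k. Suc k choose 2 = n}"
proof (rule finite_subset)
  show "{k. Suc k choose 2 = n} \<subseteq> {..n}"
    by (auto simp: numeral_2_eq_2)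
qed simp

text \<open>Terms equally far from the centre are paired; in \<open>euler_cube\<close> they carry
  the same power of \<open>fps_X\<close> with opposite signs.\<close>

lemma sum_atMost_centre:
  fixes g :: "nat \<Rightarrow> 'a::comm_monoid_add"
  shows "(\<Sum>i\<le>M + Suc M. g i) = (\<Sum>k\<le>M. g (Suc M + k)) + (\<Sum>k\<le>M. g (M - k))"
proof -
  have "{..M + Suc M} = {..M} \<union> {Suc M..M + Suc M}" by auto
  then have "(\<Sum>i\<le>M + Suc M. g i) = (\<Sum>i\<le>M. g i) + (\<Sum>i\<in>{Suc M..M + Suc M}. g i)"
    by (simp add: sum.union_disjoint)
  also have "(\<Sum>i\<le>M. g i) = (\<Sum>k\<le>M. g (M - k))"
    by (rule sum.reindex_bij_witness[of _ "\<lambda>k. M - k" "\<lambda>k. M - k"]) auto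
  also have "(\<Sum>i\<in>{Suc M..M + Suc M}. g i) = (\<Sum>k\<le>M. g (Suc M + k))"
    by (rule sum.reindex_bij_witness[of _ "\<lambda>k. Suc M + k" "\<lambda>i. i - Suc M"]) auto
  finally show ?thesis by (simp add: add.commute)
qed

text \<open>With \<open>a = - z p\<close> and \<open>b = - 1\<close> the second product of the
  finite triple product starts with \<open>z - 1\<close>. Differentiating at \<open>z = 1\<close>
  removes this factor on the left and turns \<open>z ^ i\<close> into the weight \<open>i\<close> on
  the right; \<open>d\<close> is the rest of the theta term.\<close>

lemma finite_jacobi:
  fixes p :: "'a::idom"
  defines "d \<equiv> \<lambda>n i. if n \<le> i then (- p) ^ (i - n) * p ^ ((i - n) choose 2)
     else (- 1) ^ (n - i) * p ^ ((n - i) choose 2)"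
  shows "(\<Prod>j<m. 1 - p ^ Suc j) * (\<Prod>j<n. 1 - p ^ Suc j)
     = (\<Sum>i\<le>m + Suc n. qbinomial p (m + Suc n) i * (of_nat i * d (Suc n) i))"
proof -
  define Z where "Z = [:0, 1 :: 'a:]"
  define G where "G = (\<Prod>j<m. 1 + (- Z * [:p:]) * [:p:] ^ j) * (\<Prod>j<n. Z + (- 1) * [:p:] ^ Suc j)"
  have ev: "poly (F1 * F2) 1 = poly F1 1 * poly F2 1" for F1 F2 :: "'a poly" by simp
  have T: "theta_term (- Z * [:p:]) (- 1) Z [:p:] n i = smult (d n i) (Z ^ i)" for n i
  proof (cases "n \<le> i")
    case True
    then have "Z ^ i = Z ^ (i - n) * Z ^ n" by (simp flip: power_add)
    moreover have "(- Z * [:p:]) ^ (i - n) = [:(- p) ^ (i - n):] * Z ^ (i - n)"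
    proof -
      have "- Z * [:p:] = [:- p:] * Z" by (simp add: Z_def)
      then show ?thesis by (simp only: power_mult_distrib poly_const_pow)
    qed
    ultimately show ?thesis using True
      by (simp add: theta_term_def d_def poly_const_pow mult_ac)
  next
    case False
    have "(- 1 :: 'a poly) ^ k = [:(- 1) ^ k:]" for k
      by (simp add: one_pCons flip: poly_const_pow)
    with False show ?thesis
      by (simp add: theta_term_def d_def poly_const_pow mult_ac)
  qed
  have pd: "poly (pderiv (Z ^ i)) 1 = of_nat i" for i
  proof -
    have "Z ^ i = monom 1 i" by (simp add: Z_def monom_altdef)
    then show ?thesis by (simp add: pderiv_monom poly_monom)
  qed
  have "(Z - 1) * G = (\<Prod>j<m. 1 + (- Z * [:p:]) * [:p:] ^ j) * (\<Prod>j<Suc n. Z + (- 1) * [:p:] ^ j)"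
    unfolding prod.lessThan_Suc_shift G_def by (simp add: mult_ac)
  also have "\<dots> = (\<Sum>i\<le>m + Suc n. qbinomial [:p:] (m + Suc n) i * theta_term (- Z * [:p:]) (- 1) Z [:p:] (Suc n) i)"
    by (rule finite_triple_product) (simp add: Z_def)
  also have "\<dots> = (\<Sum>i\<le>m + Suc n. smult (qbinomial p (m + Suc n) i * d (Suc n) i) (Z ^ i))"
    unfolding T qbinomial_const_poly by (intro sum.cong refl) (simp add: mult.commute)
  finally have "poly (pderiv ((Z - 1) * G)) 1 = poly (pderiv \<dots>) 1" by simp
  also have "\<dots> = (\<Sum>i\<le>m + Suc n. qbinomial p (m + Suc n) i * (of_nat i * d (Suc n) i))"
    unfolding higher_pderiv_sum[of "Suc 0", simplified] poly_sum pderiv_smult poly_smult pd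
    by (intro sum.cong refl) (simp only: mult_ac)
  \<comment> \<open>In the product rule the summand that still contains \<open>Z - 1\<close>
    vanishes at 1.\<close>
  also have "poly (pderiv ((Z - 1) * G)) 1 = poly G 1"
    by (simp add: pderiv_mult pderiv_diff Z_def pderiv_pCons)
  also have "\<dots> = (\<Prod>j<m. 1 - p ^ Suc j) * (\<Prod>j<n. 1 - p ^ Suc j)"
    by (simp add: G_def poly_prod Z_def poly_const_pow mult.commute[of _ p])
  finally show ?thesis .
qed

definition jacobi :: "rat fps" where
  "jacobi = Abs_fps (\<lambda>n. \<Sum>k | Suc k choose 2 = n. (- 1) ^ k * of_nat (2 * k + 1))"

text \<open>Two Euler products come from \<open>finite_jacobi\<close>, and the third cancels the
  Gaussian binomials. Pairing the terms at \<open>Suc M + k\<close> and \<open>M - k\<close> leaves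
  the difference \<open>2 * k + 1\<close> of their weights.\<close>

theorem euler_cube: "euler 1 ^ 3 = jacobi"
proof (rule fps_eqI_agree)
  fix n :: nat
  define M where "M = 2 * n + 2"
  let ?p = "fps_X :: rat fps"
  define d where "d = (\<lambda>i. if Suc M \<le> i then (- ?p) ^ (i - Suc M) * ?p ^ ((i - Suc M) choose 2)
     else (- 1) ^ (Suc M - i) * ?p ^ ((Suc M - i) choose 2))"
  have d1: "d (Suc M + k) = fps_const ((- 1) ^ k) * ?p ^ (Suc k choose 2)" for k
  proof -
    have "(- ?p) ^ k = fps_const ((- 1) ^ k) * ?p ^ k"
      by (subst power_minus) (simp flip: fps_const_power fps_const_neg)
    then show ?thesis by (simp add: d_def numeral_2_eq_2 power_add mult_ac)
  qed
  have d2: "d (M - k) = - fps_const ((- 1) ^ k) * ?p ^ (Suc k choose 2)" if "k \<le> M" for k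
  proof -
    have "(- 1 :: rat fps) ^ k = fps_const ((- 1) ^ k)"
      by (simp flip: fps_const_power fps_const_neg)
    moreover have "\<not> Suc M \<le> M - k" by simp
    ultimately show ?thesis using that by (simp add: d_def Suc_diff_le)
  qed
  have big: "k \<le> Suc k choose 2" for k by (simp add: numeral_2_eq_2)
  have "euler 1 ^ 3 = euler 1 * (euler 1 * euler 1)"
    by (simp add: power3_eq_cube)
  also have "fps_agree n \<dots> (euler 1 * ((\<Prod>j<M. 1 - (?p ^ 1) ^ Suc j) * (\<Prod>j<M. 1 - (?p ^ 1) ^ Suc j)))"
    by (intro fps_agree_mult euler_agree fps_agree_refl) (auto simp: M_def)
  also have "\<dots> = euler 1 * (\<Sum>i\<le>M + Suc M. qbinomial (?p ^ 1) (M + Suc M) i * (of_nat i * d i))"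
    by (simp only: finite_jacobi power_one_right d_def)
  also have "fps_agree n \<dots> (\<Sum>i\<le>M + Suc M. of_nat i * d i)"
  proof (rule euler_qbinomial_sum_agree)
    fix i assume i: "i \<le> M + Suc M" "i \<le> n \<or> M + Suc M - i \<le> n"
    \<comment> \<open>Near both ends \<open>k\<close> exceeds \<open>n\<close>, and the exponent
      \<open>Suc k choose 2\<close> is at least \<open>k\<close>.\<close>
    have "\<exists>k c. k > n \<and> d i = c * ?p ^ (Suc k choose 2)"
    proof (cases "i \<le> M")
      case True
      then show ?thesis using d2[of "M - i"] i by (intro exI[of _ "M - i"]) (auto simp: M_def)
    next
      case False
      then obtain k where "i = Suc M + k" by (metis le_Suc_ex not_less_eq_eq)
      with d1[of k] i show ?thesis by (intro exI[of _ k]) (auto simp: M_def)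
    qed
    then obtain k c where k: "k > n" "d i = c * ?p ^ (Suc k choose 2)" by blast
    show "fps_agree n (of_nat i * d i) 0"
      unfolding fps_agree_def
    proof safe
      fix r assume "r \<le> n"
      with k big[of k] have "r < Suc k choose 2" by linarith
      then show "(of_nat i * d i) $ r = 0 $ r"
        unfolding k mult.assoc[symmetric] by (subst fps_X_power_mult_right_nth) simp
    qed
  qed simp
  also have "(\<Sum>i\<le>M + Suc M. of_nat i * d i) = (\<Sum>k\<le>M. of_nat (Suc M + k) * d (Suc M + k)) + (\<Sum>k\<le>M. of_nat (M - k) * d (M - k))"
    by (rule sum_atMost_centre)
  also have "\<dots> = (\<Sum>k\<le>M. fps_const ((- 1) ^ k * of_nat (2 * k + 1)) * ?p ^ (Suc k choose 2))"
    unfolding sum.distrib [symmetric]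
  proof (intro sum.cong refl)
    fix k assume "k \<in> {..M}"
    then have k: "k \<le> M" by simp
    have "of_nat (Suc M + k) * d (Suc M + k) + of_nat (M - k) * d (M - k)
      = (of_nat (Suc M + k) - of_nat (M - k)) * (fps_const ((- 1) ^ k) * ?p ^ (Suc k choose 2))"
      unfolding d1 d2[OF k] by (simp add: algebra_simps del: fps_const_neg)
    also have "of_nat (Suc M + k) - of_nat (M - k) = (of_nat (2 * k + 1) :: rat fps)"
      using k by (simp add: of_nat_diff)
    also have "\<dots> = fps_const (of_nat (2 * k + 1))" by (simp only: fps_of_nat)
    finally show "of_nat (Suc M + k) * d (Suc M + k) + of_nat (M - k) * d (M - k)
       = fps_const ((- 1) ^ k * of_nat (2 * k + 1)) * ?p ^ (Suc k choose 2)"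
      by (simp only: fps_const_mult [symmetric] mult_ac)
  qed
  also have "fps_agree n \<dots> jacobi"
    unfolding fps_agree_def
  proof safe
    fix r assume r: "r \<le> n"
    have "(\<Sum>k\<le>M. fps_const ((- 1) ^ k * of_nat (2 * k + 1)) * ?p ^ (Suc k choose 2)) $ r
      = (\<Sum>k\<le>M. if Suc k choose 2 = r then (- 1) ^ k * of_nat (2 * k + 1) else 0)"
      unfolding fps_sum_nth
      by (intro sum.cong refl) (auto simp del: of_nat_Suc of_nat_add of_nat_mult)
    also have "\<dots> = (\<Sum>k | k \<le> M \<and> Suc k choose 2 = r. (- 1) ^ k * of_nat (2 * k + 1))"
      by (subst sum.inter_filter [symmetric]) simp_all
    also have "{k. k \<le> M \<and> Suc k choose 2 = r} = {k. Suc k choose 2 = r}"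
      using big r by (auto simp: M_def) (metis le_SucI le_trans trans_le_add1 mult_2)
    finally show "(\<Sum>k\<le>M. fps_const ((- 1) ^ k * of_nat (2 * k + 1)) * ?p ^ (Suc k choose 2)) $ r = jacobi $ r"
      by (simp add: jacobi_def)
  qed
  finally show "fps_agree n (euler 1 ^ 3) jacobi" .
qed

section \<open>The 3-dissection of the Euler products\<close>

lemma fps_compose_X_power_nth:
  fixes f :: "'a::comm_ring_1 fps"
  assumes "c > 0"
  shows "(f oo fps_X ^ c) $ n = (if c dvd n then f $ (n div c) else 0)"
proof -
  have "(f oo fps_X ^ c) $ n = (\<Sum>i=0..n. if c * i = n then f $ i else 0)"
    unfolding fps_compose_nth by (intro sum.cong refl) (auto simp: power_mult [symmetric])
  also have "\<dots> = (\<Sum>i=0..n. if i = n div c then (if c dvd n then f $ i else 0) else 0)"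
    using assms by (intro sum.cong refl) auto
  also have "\<dots> = (if c dvd n then f $ (n div c) else 0)" by simp
  finally show ?thesis .
qed

lemma fps_agree_compose:
  fixes f :: "'a::comm_ring_1 fps"
  shows "fps_agree n f f' \<Longrightarrow> fps_agree n (f oo g) (f' oo g)"
  by (auto simp: fps_agree_def fps_compose_nth intro!: sum.cong)

lemma qprod_compose:
  assumes "c > 0" "d > 0"
  shows "qprod s a d oo fps_X ^ c = qprod s (c * a) (c * d)"
proof (rule fps_eqI_agree)
  fix n
  define M where "M = Suc n"
  have "fps_agree n (qprod s a d oo fps_X ^ c) ((\<Prod>j<M. 1 + fps_const s * fps_X ^ (a + d * j)) oo fps_X ^ c)"
    by (intro fps_agree_compose qprod_agree) (use assms in \<open>auto simp: M_def\<close>)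
  also have "\<dots> = (\<Prod>j<M. 1 + fps_const s * fps_X ^ (c * a + c * d * j))"
  proof -
    have c0: "(fps_X ^ c) $ 0 = (0 :: rat)" using assms by simp
    have "(1 + fps_const s * fps_X ^ (a + d * j)) oo fps_X ^ c = 1 + fps_const s * fps_X ^ (c * a + c * d * j)" for j
      using assms by (simp add: fps_compose_add_distrib fps_compose_mult_distrib[OF c0] fps_X_power_compose
          algebra_simps flip: power_mult)
    then show ?thesis by (simp add: fps_compose_prod_distrib[OF c0])
  qed
  also have "fps_agree n \<dots> (qprod s (c * a) (c * d))"
    by (rule fps_agree_sym, rule qprod_agree) (use assms in \<open>auto simp: M_def\<close>)
  finally show "fps_agree n (qprod s a d oo fps_X ^ c) (qprod s (c * a) (c * d))" .
qed

lemma euler_compose: "c > 0 \<Longrightarrow> d > 0 \<Longrightarrow> euler d oo fps_X ^ c = euler (c * d)"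
  by (simp add: qprod_compose)

lemma qprod_shift:
  assumes "c > 0"
  shows "qprod s a c = (1 + fps_const s * fps_X ^ a) * qprod s (a + c) c"
proof (rule fps_eqI_agree)
  fix n
  define M where "M = Suc n"
  have "fps_agree n (qprod s a c) (\<Prod>j<Suc M. 1 + fps_const s * fps_X ^ (a + c * j))"
    by (intro qprod_agree) (use assms in \<open>auto simp: M_def\<close>)
  also have "\<dots> = (1 + fps_const s * fps_X ^ a) * (\<Prod>j<M. 1 + fps_const s * fps_X ^ (a + c + c * j))"
    unfolding prod.lessThan_Suc_shift by (simp add: add.assoc)
  also have "fps_agree n \<dots> ((1 + fps_const s * fps_X ^ a) * qprod s (a + c) c)"
    by (intro fps_agree_mult fps_agree_refl fps_agree_sym[OF qprod_agree]) (use assms in \<open>auto simp: M_def\<close>)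
  finally show "fps_agree n (qprod s a c) ((1 + fps_const s * fps_X ^ a) * qprod s (a + c) c)" .
qed

text \<open>Euler's theorem on partitions into odd parts and into distinct parts: after
  multiplication by \<open>euler c\<close>, both sides reduce to \<open>euler c\<close>.\<close>

lemma qprod_odd_mult_distinct:
  assumes "c > 0"
  shows "qprod (-1) c (2 * c) * qprod 1 c c = 1"
proof -
  have "qprod (-1) c (2 * c) * qprod 1 c c * euler c = qprod (-1) c (2 * c) * euler (2 * c)"
    using qprod_mult_minus[OF assms, of c] by (simp add: mult.assoc)
  also have "\<dots> = 1 * euler c"
    using qprod_split2[OF assms, of "-1" c] by (simp flip: mult_2)
  finally show ?thesis
    using qprod_nonzero[of c c "-1"] assms by simp
qed

text \<open>Gauss's phi(-q) psi(q) for q = X^c. The factor 2 arises because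
  \<open>\<alpha> = 0\<close> makes the first factor of a \<open>qprod\<close> equal to 2, so
  \<open>theta 1 0 c\<close> is twice psi.\<close>

lemma gauss_theta_mult:
  assumes "c > 0"
  shows "theta (-1) c c * theta 1 0 c = 2 * (euler c * euler (2 * c))"
proof -
  let ?u = "qprod (-1) c (2 * c)" and ?w = "qprod 1 c c" and ?e = "euler c" and ?e2 = "euler (2 * c)"
  have "theta (-1) c c = ?u * ?u * ?e2"
    using triple_product[of "-1" c c] assms by (simp flip: mult_2)
  moreover have "theta 1 0 c = 2 * ?w * ?w * ?e"
    using triple_product[of 1 0 c] qprod_shift[of c 1 0] assms by simp
  moreover have "?u * ?w = 1" by (rule qprod_odd_mult_distinct[OF assms])
  moreover have "2 * ?w * ?w * ?e * (?u * ?u * ?e2) = (?u * ?w) * (?u * ?w) * (2 * (?e * ?e2))"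
    by (simp only: mult_ac)
  ultimately show ?thesis by (simp add: mult_ac)
qed

text \<open>Each theta product lacks one residue class modulo 3. Inserting the missing classes,
  whose product is 1 by Euler's theorem for \<open>3 * c\<close>, completes the rest to Euler's
  theorem for \<open>c\<close>.\<close>

lemma cubic_theta_mult:
  assumes "c > 0"
  shows "theta (-1) c (5 * c) * theta 1 c (2 * c) = euler (3 * c) * euler (6 * c)"
proof -
  have 1: "theta (-1) c (5 * c) = qprod (-1) c (6 * c) * qprod (-1) (5 * c) (6 * c) * euler (6 * c)"
    using triple_product[of "-1" c "5 * c"] assms by simp
  have 2: "theta 1 c (2 * c) = qprod 1 c (3 * c) * qprod 1 (2 * c) (3 * c) * euler (3 * c)"
    using triple_product[of 1 c "2 * c"] assms by simp
  have 3: "qprod (-1) c (6 * c) * qprod (-1) (3 * c) (6 * c) * qprod (-1) (5 * c) (6 * c) = qprod (-1) c (2 * c)"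
    using qprod_split3[of "2 * c" "-1" c] assms by simp
  have 4: "qprod 1 c (3 * c) * qprod 1 (2 * c) (3 * c) * qprod 1 (3 * c) (3 * c) = qprod 1 c c"
    using qprod_split3[of c 1 c] assms by (simp flip: mult_2)
  have 5: "qprod (-1) (3 * c) (6 * c) * qprod 1 (3 * c) (3 * c) = 1"
    using qprod_odd_mult_distinct[of "3 * c"] assms by simp
  have "theta (-1) c (5 * c) * theta 1 c (2 * c) =
     theta (-1) c (5 * c) * theta 1 c (2 * c) * (qprod (-1) (3 * c) (6 * c) * qprod 1 (3 * c) (3 * c))"
    unfolding 5 by simp
  also have "\<dots> = (qprod (-1) c (6 * c) * qprod (-1) (3 * c) (6 * c) * qprod (-1) (5 * c) (6 * c))
      * (qprod 1 c (3 * c) * qprod 1 (2 * c) (3 * c) * qprod 1 (3 * c) (3 * c)) * (euler (3 * c) * euler (6 * c))"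
    unfolding 1 2 by (simp only: mult_ac)
  also have "\<dots> = euler (3 * c) * euler (6 * c)"
    unfolding 3 4 qprod_odd_mult_distinct[OF assms] by simp
  finally show ?thesis .
qed

section \<open>Power series in X^c and the dissection of the product\<close>

definition fps_in_power :: "nat \<Rightarrow> 'a::zero fps \<Rightarrow> bool" where
  "fps_in_power c f \<longleftrightarrow> (\<forall>n. \<not> c dvd n \<longrightarrow> f $ n = 0)"

lemma fps_in_power_mult:
  fixes f g :: "'a::comm_ring_1 fps"
  assumes "fps_in_power c f" "fps_in_power c g"
  shows "fps_in_power c (f * g)"
  unfolding fps_in_power_def fps_mult_nth
proof (intro allI impI sum.neutral ballI)
  fix n i assume n: "\<not> c dvd n" and i: "i \<in> {0..n}"
  then have "\<not> (c dvd i \<and> c dvd (n - i))"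
    using dvd_add[of c i "n - i"] by auto
  then show "f $ i * g $ (n - i) = 0" using assms by (auto simp: fps_in_power_def)
qed

lemma fps_in_power_const: "fps_in_power c (fps_const a)"
  by (auto simp: fps_in_power_def)

lemma fps_in_power_numeral: "fps_in_power c (numeral k :: 'a::comm_ring_1 fps)"
  using fps_in_power_const[of c "numeral k :: 'a"] by (simp only: numeral_fps_const)

lemma fps_in_power_1: "fps_in_power c (1 :: 'a::comm_ring_1 fps)"
  by (auto simp: fps_in_power_def)

lemma fps_in_power_power:
  fixes f :: "'a::comm_ring_1 fps"
  shows "fps_in_power c f \<Longrightarrow> fps_in_power c (f ^ k)"
  by (induction k) (simp_all add: fps_in_power_mult fps_in_power_1)

lemma fps_in_power_add:
  fixes f g :: "'a::comm_ring_1 fps"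
  shows "fps_in_power c f \<Longrightarrow> fps_in_power c g \<Longrightarrow> fps_in_power c (f + g)"
  by (simp add: fps_in_power_def)

lemma fps_in_power_diff:
  fixes f g :: "'a::comm_ring_1 fps"
  shows "fps_in_power c f \<Longrightarrow> fps_in_power c g \<Longrightarrow> fps_in_power c (f - g)"
  by (simp add: fps_in_power_def)

lemma fps_in_power_X: "fps_in_power c (fps_X ^ c :: 'a::comm_ring_1 fps)"
  by (auto simp: fps_in_power_def fps_X_power_nth)

lemmas fps_in_power_intros = fps_in_power_mult fps_in_power_numeral fps_in_power_const fps_in_power_1
  fps_in_power_power fps_in_power_add fps_in_power_diff fps_in_power_X

lemma fps_in_power_euler: "c > 0 \<Longrightarrow> d > 0 \<Longrightarrow> fps_in_power c (euler (c * d))"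
  unfolding euler_compose[symmetric]
  by (auto simp: fps_in_power_def fps_compose_X_power_nth)

lemma fps_in_power_theta:
  assumes "\<alpha> + \<beta> > 0"
  shows "fps_in_power c (theta s (c * \<alpha>) (c * \<beta>))"
  unfolding fps_in_power_def
proof (intro allI impI)
  fix n assume n: "\<not> c dvd n"
  have "theta_exp (c * \<alpha>) (c * \<beta>) k \<noteq> 2 * int n" for k
  proof
    assume "theta_exp (c * \<alpha>) (c * \<beta>) k = 2 * int n"
    moreover have "even (k * (k + 1))" "even (k * (k - 1))" by simp_all
    then obtain u v where "k * (k + 1) = 2 * u" "k * (k - 1) = 2 * v" by (metis dvdE)
    ultimately have "2 * int n = int (c * \<alpha>) * (2 * u) + int (c * \<beta>) * (2 * v)"
      by (simp only: theta_exp_def)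
    then have "int n = int c * (int \<alpha> * u + int \<beta> * v)"
      by (simp add: algebra_simps)
    then have "int c dvd int n" by (metis dvd_triv_left)
    with n show False by simp
  qed
  then show "theta s (c * \<alpha>) (c * \<beta>) $ n = 0" by (simp add: theta_def)
qed

text \<open>Twice the product is phi(-q) times 2 psi(q), namely
  \<open>(?a - 2 * fps_X * ?w) * (2 * ?P + fps_X * ?y)\<close>. Both cross terms are multiples of
  \<open>?B\<close>, because \<open>?a * ?y = 2 * ?B\<close> and \<open>?w * ?P = ?B\<close>; the
  same two relations give \<open>A * C = ?B ^ 2\<close>.\<close>

lemma euler_1_2_dissection:
  obtains A C where "euler 1 * euler 2 = A - fps_X * (euler 9 * euler 18) - 2 * fps_X ^ 2 * C"
    and "A * C = (euler 9 * euler 18) ^ 2" and "fps_in_power 3 A" and "fps_in_power 3 C"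
proof -
  let ?a = "theta (-1) 9 9" and ?w = "theta (-1) 3 15" and ?P = "theta 1 3 6" and ?y = "theta 1 0 9"
  let ?B = "euler 9 * euler 18" and ?h = "fps_const (1 / 2) :: rat fps"
  have h: "?h * (2 * f) = f" for f :: "rat fps"
    by (simp add: numeral_fps_const flip: mult.assoc)
  have h2: "2 * (?h * f) = f" for f :: "rat fps"
    by (subst mult.left_commute) (rule h)
  have ay: "?a * ?y = 2 * ?B" using gauss_theta_mult[of 9] by simp
  have wP: "?w * ?P = ?B" using cubic_theta_mult[of 3] by simp
  \<comment> \<open>For equal parameters the classes \<open>3 * l + 1\<close> and
    \<open>3 * l - 1\<close> give the same series by symmetry, hence the coefficient 2.\<close>
  have phi: "theta (-1) 1 1 = ?a - 2 * fps_X * ?w"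
    using theta_dissection_3[of "-1" 1 1] theta_commute[of "-1" 15 3]
    by (simp add: algebra_simps flip: fps_const_neg)
  have psi: "theta 1 0 1 = 2 * ?P + fps_X * ?y"
    using theta_dissection_3[of 1 0 1] theta_commute[of 1 6 3] by simp
  define A where "A = ?a * ?P"
  define C where "C = ?h * (?w * ?y)"
  have "2 * (euler 1 * euler 2) = theta (-1) 1 1 * theta 1 0 1"
    using gauss_theta_mult[of 1] by simp
  also have "\<dots> = 2 * (?a * ?P) + fps_X * (?a * ?y) - 4 * fps_X * (?w * ?P) - fps_X ^ 2 * (2 * (?w * ?y))"
    unfolding phi psi by (simp add: algebra_simps power2_eq_square)
  also have "\<dots> = 2 * (A - fps_X * ?B - 2 * fps_X ^ 2 * C)"
  proof -
    have "?w * ?y = 2 * C" by (simp only: C_def h2)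
    then show ?thesis unfolding ay wP A_def by (simp add: algebra_simps)
  qed
  finally have "euler 1 * euler 2 = A - fps_X * ?B - 2 * fps_X ^ 2 * C"
    by (simp only: mult_cancel_left) simp
  moreover have "A * C = ?h * (?a * ?y) * (?w * ?P)" by (simp only: A_def C_def mult_ac)
  then have "A * C = ?B ^ 2" unfolding ay wP h by (simp add: power2_eq_square)
  moreover have "fps_in_power 3 A" "fps_in_power 3 C"
    using fps_in_power_theta[of 3 3 3 "-1"] fps_in_power_theta[of 1 5 3 "-1"]
      fps_in_power_theta[of 1 2 3 1] fps_in_power_theta[of 0 3 3 1]
    by (auto simp: A_def C_def intro!: fps_in_power_intros)
  ultimately show thesis by (rule that)
qed

lemma fps_in_power_mult_X_nth:
  fixes f :: "'a::comm_ring_1 fps"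
  assumes "fps_in_power c f" "n mod c \<noteq> k mod c"
  shows "(fps_X ^ k * f) $ n = 0"
  using assms by (auto simp: fps_X_power_mult_nth fps_in_power_def mod_eq_dvd_iff_nat not_less)

text \<open>Terms are grouped by the exponent of \<open>x\<close> modulo 3. In the class of 2 those
  at \<open>x ^ 2\<close> and \<open>x ^ 8\<close> cancel; at \<open>x ^ 5\<close> the monomials
  \<open>B ^ 5\<close>, \<open>A * B ^ 3 * C\<close> and \<open>A ^ 2 * B * C ^ 2\<close> coincide
  and yield -1 + 40 - 120 = -81.\<close>

lemma fifth_power_dissection:
  fixes A B C x :: "'a::idom"
  assumes AC: "A * C = B ^ 2"
  shows "(A - x * B - 2 * x ^ 2 * C) ^ 5 =
    (A ^ 5 + x ^ 3 * (40 * A ^ 3 * B * C - 10 * A ^ 2 * B ^ 3)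
      + (x ^ 3) ^ 2 * (120 * A * B ^ 2 * C ^ 2 - 10 * B ^ 4 * C - 80 * A ^ 2 * C ^ 3)
      - (x ^ 3) ^ 3 * (80 * B * C ^ 4))
    + x * (x ^ 3 * (5 * A * B ^ 4 - 60 * A ^ 2 * B ^ 2 * C + 40 * A ^ 3 * C ^ 2) - 5 * A ^ 4 * B
      + (x ^ 3) ^ 2 * (160 * A * B * C ^ 3 - 40 * B ^ 3 * C ^ 2) - (x ^ 3) ^ 3 * (32 * C ^ 5))
    - 81 * (x ^ 5 * B ^ 5)"
proof -
  \<comment> \<open>An identity valid without the relation; its last line collects the multiples of
    \<open>B ^ 2 - A * C\<close>.\<close>
  have "(A - x * B - 2 * x ^ 2 * C) ^ 5 =
      (A ^ 5 + x ^ 3 * (40 * A ^ 3 * B * C - 10 * A ^ 2 * B ^ 3)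
        + (x ^ 3) ^ 2 * (120 * A * B ^ 2 * C ^ 2 - 10 * B ^ 4 * C - 80 * A ^ 2 * C ^ 3)
        - (x ^ 3) ^ 3 * (80 * B * C ^ 4))
      + x * (x ^ 3 * (5 * A * B ^ 4 - 60 * A ^ 2 * B ^ 2 * C + 40 * A ^ 3 * C ^ 2) - 5 * A ^ 4 * B
        + (x ^ 3) ^ 2 * (160 * A * B * C ^ 3 - 40 * B ^ 3 * C ^ 2) - (x ^ 3) ^ 3 * (32 * C ^ 5))
      - 81 * (x ^ 5 * B ^ 5)
      + x ^ 2 * (10 * A ^ 3 - 80 * x ^ 6 * C ^ 3 ) * (B ^ 2 - A * C) + x ^ 5 * (80 * B ^ 3 + 120 * A * B * C) * (B ^ 2 - A * C)"
    by algebra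
  then show ?thesis by (simp add: AC)
qed

text \<open>On the relevant residue class only \<open>- 81 * (fps_X ^ 5 * ?B ^ 5)\<close> survives,
  and \<open>?B ^ 5\<close> is \<open>F\<close> evaluated at X^9. The substitution
  \<open>n = 9 * n' + 5\<close> is multiplication of \<open>8 * n' + 5\<close> by 9.\<close>

lemma euler_1_2_fifth_power_nth:
  defines "F \<equiv> (euler 1 * euler 2) ^ 5"
  shows "3 dvd 8 * n + 5 \<Longrightarrow> \<not> 9 dvd 8 * n + 5 \<Longrightarrow> F $ n = 0"
    and "8 * n + 5 = 9 * (8 * n' + 5) \<Longrightarrow> F $ n = - 81 * F $ n'"
proof -
  obtain A C where AC: "euler 1 * euler 2 = A - fps_X * (euler 9 * euler 18) - 2 * fps_X ^ 2 * C"
    "A * C = (euler 9 * euler 18) ^ 2" "fps_in_power 3 A" "fps_in_power 3 C"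
    by (rule euler_1_2_dissection)
  let ?B = "euler 9 * euler 18"
  have B: "fps_in_power 3 ?B"
    using fps_in_power_euler[of 3 3] fps_in_power_euler[of 3 6] by (auto intro: fps_in_power_mult)
  obtain R0 R1 where F: "F = fps_X ^ 0 * R0 + fps_X ^ 1 * R1 - 81 * (fps_X ^ 5 * ?B ^ 5)"
    and R: "fps_in_power 3 R0" "fps_in_power 3 R1"
  proof (rule that)
    show "F = fps_X ^ 0 * (A ^ 5 + fps_X ^ 3 * (40 * A ^ 3 * ?B * C - 10 * A ^ 2 * ?B ^ 3)
      + (fps_X ^ 3) ^ 2 * (120 * A * ?B ^ 2 * C ^ 2 - 10 * ?B ^ 4 * C - 80 * A ^ 2 * C ^ 3)
      - (fps_X ^ 3) ^ 3 * (80 * ?B * C ^ 4))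
    + fps_X ^ 1 * (fps_X ^ 3 * (5 * A * ?B ^ 4 - 60 * A ^ 2 * ?B ^ 2 * C + 40 * A ^ 3 * C ^ 2) - 5 * A ^ 4 * ?B
      + (fps_X ^ 3) ^ 2 * (160 * A * ?B * C ^ 3 - 40 * ?B ^ 3 * C ^ 2) - (fps_X ^ 3) ^ 3 * (32 * C ^ 5))
    - 81 * (fps_X ^ 5 * ?B ^ 5)"
      unfolding F_def AC(1) fifth_power_dissection[OF AC(2)] by simp
  qed (intro fps_in_power_intros AC B)+
  have "?B = (euler 1 * euler 2) oo fps_X ^ 9"
    by (simp add: fps_compose_mult_distrib euler_compose)
  then have B5: "?B ^ 5 = F oo fps_X ^ 9"
    by (simp add: F_def fps_compose_power)
  have 81: "(81 * f) $ k = 81 * f $ k" for f :: "rat fps" and k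
    by (simp add: numeral_fps_const)
  have F_nth: "F $ n = - 81 * (fps_X ^ 5 * (F oo fps_X ^ 9)) $ n" if "3 dvd 8 * n + 5" for n
  proof -
    \<comment> \<open>The condition \<open>3 dvd 8 * n + 5\<close> says that \<open>n\<close> is 2
      modulo 3.\<close>
    from that have "n mod 3 \<noteq> 0 mod 3" "n mod 3 \<noteq> 1 mod 3"
      by presburger+
    then have "(fps_X ^ 0 * R0) $ n = 0" "(fps_X ^ 1 * R1) $ n = 0"
      using R by (blast intro: fps_in_power_mult_X_nth)+
    moreover have "F $ n = (fps_X ^ 0 * R0 + fps_X ^ 1 * R1 - 81 * (fps_X ^ 5 * ?B ^ 5)) $ n"
      using F by (rule arg_cong)
    ultimately show ?thesis
      unfolding B5 fps_sub_nth fps_add_nth 81 by simp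
  qed
  have comp: "(fps_X ^ 5 * (F oo fps_X ^ 9)) $ n = (if n \<ge> 5 \<and> 9 dvd n - 5 then F $ ((n - 5) div 9) else 0)" for n
    by (subst fps_X_power_mult_nth, subst fps_compose_X_power_nth) auto
  show "F $ n = 0" if "3 dvd 8 * n + 5" "\<not> 9 dvd 8 * n + 5"
  proof -
    have not5: "\<not> (n \<ge> 5 \<and> 9 dvd n - 5)"
    proof
      assume "n \<ge> 5 \<and> 9 dvd n - 5"
      then obtain k where "n = 5 + 9 * k" by (metis dvdE le_add_diff_inverse)
      with that show False by presburger
    qed
    show ?thesis by (simp only: F_nth[OF that(1)] comp not5 if_False mult_zero_right)
  qed
  show "F $ n = - 81 * F $ n'" if "8 * n + 5 = 9 * (8 * n' + 5)"
  proof -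
    from that have "n = 5 + 9 * n'" "3 dvd 8 * n + 5" by presburger+
    then show ?thesis using F_nth[of n] comp[of n] by simp
  qed
qed

section \<open>Cubes of Euler products modulo 5\<close>

lemma sparse_fps_mult_nth:
  fixes f g :: "nat \<Rightarrow> 'a::comm_ring_1"
  assumes fin: "\<And>n. finite {i. d i = n}" "\<And>n. finite {j. e j = n}"
  shows "(Abs_fps (\<lambda>n. \<Sum>i | d i = n. f i) * Abs_fps (\<lambda>n. \<Sum>j | e j = n. g j)) $ n
    = (\<Sum>(i, j) | d i + e j = n. f i * g j)"
proof -
  let ?S = "{(i, j). d i + e j = n}"
  have split: "{x \<in> ?S. (d \<circ> fst) x = r} = {i. d i = r} \<times> {j. e j = n - r}" if "r \<le> n" for r
    using that by auto
  have finS: "finite ?S"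
  proof (rule finite_subset)
    show "?S \<subseteq> (\<Union>r\<in>{0..n}. {i. d i = r} \<times> {j. e j = n - r})" by auto
    show "finite (\<Union>r\<in>{0..n}. {i. d i = r} \<times> {j. e j = n - r})"
      using fin by (intro finite_UN_I finite_cartesian_product) auto
  qed
  have "(Abs_fps (\<lambda>n. \<Sum>i | d i = n. f i) * Abs_fps (\<lambda>n. \<Sum>j | e j = n. g j)) $ n
      = (\<Sum>r=0..n. \<Sum>x\<in>{x \<in> ?S. (d \<circ> fst) x = r}. case x of (i, j) \<Rightarrow> f i * g j)"
    unfolding fps_mult_nth
  proof (intro sum.cong refl)
    fix r assume "r \<in> {0..n}"
    then have "r \<le> n" by simp
    from split[OF this]
    show "Abs_fps (\<lambda>n. \<Sum>i | d i = n. f i) $ r * Abs_fps (\<lambda>n. \<Sum>j | e j = n. g j) $ (n - r)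
      = (\<Sum>x\<in>{x \<in> ?S. (d \<circ> fst) x = r}. case x of (i, j) \<Rightarrow> f i * g j)"
      by (simp only: fps_nth_Abs_fps sum_product sum.cartesian_product)
  qed
  also have "\<dots> = (\<Sum>x\<in>?S. case x of (i, j) \<Rightarrow> f i * g j)"
    by (rule sum.group[OF finS]) auto
  finally show ?thesis .
qed

text \<open>Squares modulo 5 are 0, 1 and 4, so neither -2 nor -3 is a square there.\<close>

lemma five_dvd_norm:
  fixes x y m :: nat
  assumes "m = 2 \<or> m = 3" "5 dvd x ^ 2 + m * y ^ 2"
  shows "5 dvd x" "5 dvd y"
proof -
  have sq: "z ^ 2 mod 5 = 0 \<and> 5 dvd z \<or> z ^ 2 mod 5 = 1 \<or> z ^ 2 mod 5 = 4" for z :: nat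
  proof -
    have "z mod 5 = 0 \<or> z mod 5 = 1 \<or> z mod 5 = 2 \<or> z mod 5 = 3 \<or> z mod 5 = 4" by presburger
    moreover have "z ^ 2 mod 5 = (z mod 5) ^ 2 mod 5" by (simp only: power_mod)
    ultimately show ?thesis by (elim disjE) (simp_all add: mod_0_imp_dvd)
  qed
  have "(x ^ 2 mod 5 + m * (y ^ 2 mod 5)) mod 5 = (x ^ 2 + m * y ^ 2) mod 5"
    by (intro mod_add_cong) (simp_all add: mod_mult_right_eq)
  then have "(x ^ 2 mod 5 + m * (y ^ 2 mod 5)) mod 5 = 0"
    using assms(2) by (simp only: dvd_eq_mod_eq_0)
  with sq[of x] sq[of y] assms(1) show "5 dvd x" "5 dvd y"
    by (elim disjE conjE; simp)+
qed

text \<open>Jacobi's formula is applied to both cubes. Completing the square,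
  \<open>8 * (Suc i choose 2) + 1 = (2 * i + 1) ^ 2\<close>, turns the exponent equation into a
  representation by the form x^2 + m y^2.\<close>

lemma euler_mult_cube_nth:
  assumes "m > 0"
  shows "((euler 1 * euler m) ^ 3) $ n =
    (\<Sum>(i, j) | (2 * i + 1) ^ 2 + m * (2 * j + 1) ^ 2 = 8 * n + 1 + m.
       (- 1) ^ (i + j) * of_nat ((2 * i + 1) * (2 * j + 1)))"
proof -
  let ?w = "\<lambda>k. (- 1) ^ k * of_nat (2 * k + 1) :: rat"
  have "jacobi oo fps_X ^ m = Abs_fps (\<lambda>n. \<Sum>k | m * (Suc k choose 2) = n. ?w k)"
  proof (rule fps_ext)
    fix n
    have "{k. Suc k choose 2 = n div m} = {k. m * (Suc k choose 2) = n}" if "m dvd n"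
      using that assms by auto
    moreover have "{k. m * (Suc k choose 2) = n} = {}" if "\<not> m dvd n"
      using that by auto
    ultimately show "(jacobi oo fps_X ^ m) $ n = Abs_fps (\<lambda>n. \<Sum>k | m * (Suc k choose 2) = n. ?w k) $ n"
      using assms by (simp only: fps_compose_X_power_nth jacobi_def fps_nth_Abs_fps) auto
  qed
  moreover have "(euler 1 * euler m) ^ 3 = jacobi * (jacobi oo fps_X ^ m)"
  proof -
    have "euler m ^ 3 = euler 1 ^ 3 oo fps_X ^ m"
      using assms by (simp add: euler_compose flip: fps_compose_power)
    then show ?thesis by (simp only: power_mult_distrib euler_cube)
  qed
  ultimately have "((euler 1 * euler m) ^ 3) $ n =
    (\<Sum>(i, j) | (Suc i choose 2) + m * (Suc j choose 2) = n. ?w i * ?w j)"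
  proof -
    have "finite {k. m * (Suc k choose 2) = r}" for r
      by (rule finite_subset[OF _ finite_triangular[of "r div m"]]) (use assms in auto)
    then show ?thesis
      unfolding \<open>(euler 1 * euler m) ^ 3 = _\<close> \<open>jacobi oo fps_X ^ m = _\<close>
      unfolding jacobi_def by (intro sparse_fps_mult_nth finite_triangular)
  qed
  also have "{(i, j). (Suc i choose 2) + m * (Suc j choose 2) = n} =
      {(i, j). (2 * i + 1) ^ 2 + m * (2 * j + 1) ^ 2 = 8 * n + 1 + m}"
  proof -
    have sq: "(2 * i + 1) ^ 2 = 8 * (Suc i choose 2) + 1" for i :: nat
      using Suc_choose_2[of i] by (simp add: power2_eq_square algebra_simps)
    have "(2 * i + 1) ^ 2 + m * (2 * j + 1) ^ 2 = 8 * n + 1 + m \<longleftrightarrow> (Suc i choose 2) + m * (Suc j choose 2) = n" for i j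
    proof -
      have eq: "(2 * i + 1) ^ 2 + m * (2 * j + 1) ^ 2 = 8 * ((Suc i choose 2) + m * (Suc j choose 2)) + (1 + m)"
        unfolding sq by (simp add: algebra_simps)
      show ?thesis unfolding eq by (simp only: add.assoc add_right_cancel mult_cancel1) simp
    qed
    then show ?thesis by simp
  qed
  finally show ?thesis by (simp only: power_add of_nat_mult mult_ac)
qed

text \<open>If 5 divides the value of the form, it divides both odd arguments, so
  \<open>i = 5 * i' + 2\<close> and \<open>j = 5 * j' + 2\<close>. Passing to \<open>i'\<close> and
  \<open>j'\<close> divides the value by 25 and the weight by 25.\<close>

lemma euler_pair_cube_nth:
  assumes m: "m = 2 \<or> m = 3"
  defines "F \<equiv> (euler 1 * euler m) ^ 3"
  shows "5 dvd 8 * n + (m + 1) \<Longrightarrow> \<not> 25 dvd 8 * n + (m + 1) \<Longrightarrow> F $ n = 0"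
    and "8 * n + (m + 1) = 25 * (8 * n' + (m + 1)) \<Longrightarrow> F $ n = 25 * F $ n'"
proof -
  let ?S = "\<lambda>n. {(i, j). (2 * i + 1) ^ 2 + m * (2 * j + 1) ^ 2 = 8 * n + 1 + m}"
  have m0: "m > 0" using m by auto
  have five: "\<exists>i' j'. i = 5 * i' + 2 \<and> j = 5 * j' + 2"
    if "(i, j) \<in> ?S n" "5 dvd 8 * n + (m + 1)" for i j n
  proof -
    from that have "5 dvd (2 * i + 1) ^ 2 + m * (2 * j + 1) ^ 2" by (simp add: add_ac)
    from five_dvd_norm[OF m this] have "i mod 5 = 2" "j mod 5 = 2" by presburger+
    then have "i = 5 * (i div 5) + 2" "j = 5 * (j div 5) + 2" by presburger+
    then show ?thesis by blast
  qed
  have scale: "(2 * (5 * i + 2) + 1) ^ 2 + m * (2 * (5 * j + 2) + 1) ^ 2 = 25 * ((2 * i + 1) ^ 2 + m * (2 * j + 1) ^ 2)"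
    for i j by (simp add: power2_eq_square algebra_simps)
  show "F $ n = 0" if "5 dvd 8 * n + (m + 1)" "\<not> 25 dvd 8 * n + (m + 1)"
  proof -
    have "(i, j) \<notin> ?S n" for i j
    proof
      assume ij: "(i, j) \<in> ?S n"
      with five that(1) obtain i' j' where "i = 5 * i' + 2" "j = 5 * j' + 2" by blast
      with ij scale have "8 * n + (m + 1) = 25 * ((2 * i' + 1) ^ 2 + m * (2 * j' + 1) ^ 2)" by simp
      with that(2) show False by (metis dvd_triv_left)
    qed
    then have "?S n = {}" by auto
    then show ?thesis by (simp add: F_def euler_mult_cube_nth[OF m0] del: One_nat_def)
  qed
  show "F $ n = 25 * F $ n'" if n: "8 * n + (m + 1) = 25 * (8 * n' + (m + 1))"
  proof -
    have iff: "(5 * i + 2, 5 * j + 2) \<in> ?S n \<longleftrightarrow> (i, j) \<in> ?S n'" for i j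
    proof -
      have "(5 * i + 2, 5 * j + 2) \<in> ?S n \<longleftrightarrow> (2 * (5 * i + 2) + 1) ^ 2 + m * (2 * (5 * j + 2) + 1) ^ 2 = 8 * n + (m + 1)"
        by simp
      also have "\<dots> \<longleftrightarrow> (2 * i + 1) ^ 2 + m * (2 * j + 1) ^ 2 = 8 * n' + (m + 1)"
        unfolding scale n by (simp only: mult_cancel1) simp
      finally show ?thesis by simp
    qed
    have "5 dvd 8 * n + (m + 1)" unfolding n by (simp add: dvd_mult2)
    then have inv: "\<exists>i' j'. i = 5 * i' + 2 \<and> j = 5 * j' + 2" if "(i, j) \<in> ?S n" for i j
      using five that by blast
    define w where "w = (\<lambda>(i, j). (- 1) ^ (i + j) * of_nat ((2 * i + 1) * (2 * j + 1)) :: rat)"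
    have F_nth: "F $ n = sum w (?S n)" for n
      unfolding F_def w_def by (rule euler_mult_cube_nth[OF m0])
    have dv: "(5 * a + 2) div 5 = a" for a :: nat by simp
    have w: "w (5 * i + 2, 5 * j + 2) = 25 * w (i, j)" for i j
    proof -
      \<comment> \<open>The sign is unchanged, as the exponent grows by an even number.\<close>
      have "(- 1 :: rat) ^ (5 * i + 2 + (5 * j + 2)) = (- 1) ^ (i + j)"
      proof -
        have "5 * i + 2 + (5 * j + 2) = (i + j) + 2 * (2 * i + 2 * j + 2)" by simp
        then show ?thesis by (simp only: power_add power_mult) simp
      qed
      moreover have "(2 * (5 * i + 2) + 1) * (2 * (5 * j + 2) + 1) = 25 * ((2 * i + 1) * (2 * j + 1))"
        by (simp add: algebra_simps)
      ultimately show ?thesis unfolding w_def prod.case by (simp only: of_nat_mult of_nat_numeral mult_ac)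
    qed
    have "sum w (?S n) = (\<Sum>x\<in>?S n'. 25 * w x)"
    proof (rule sum.reindex_bij_witness[of _ "map_prod (\<lambda>i. 5 * i + 2) (\<lambda>j. 5 * j + 2)" "map_prod (\<lambda>i. i div 5) (\<lambda>j. j div 5)"])
      fix x assume x: "x \<in> ?S n"
      moreover obtain i j where "x = (i, j)" by (rule prod.exhaust)
      ultimately obtain i' j' where ij: "x = (5 * i' + 2, 5 * j' + 2)" using inv by blast
      show "map_prod (\<lambda>i. 5 * i + 2) (\<lambda>j. 5 * j + 2) (map_prod (\<lambda>i. i div 5) (\<lambda>j. j div 5) x) = x"
        by (simp only: ij map_prod_simp dv)
      show "map_prod (\<lambda>i. i div 5) (\<lambda>j. j div 5) x \<in> ?S n'"
        using x unfolding ij iff by (simp only: map_prod_simp dv)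
      show "25 * w (map_prod (\<lambda>i. i div 5) (\<lambda>j. j div 5) x) = w x"
        by (simp only: ij map_prod_simp dv w)
    next
      fix x assume x: "x \<in> ?S n'"
      obtain i j where ij: "x = (i, j)" by (rule prod.exhaust)
      show "map_prod (\<lambda>i. 5 * i + 2) (\<lambda>j. 5 * j + 2) x \<in> ?S n"
        using x unfolding ij map_prod_simp iff .
      show "map_prod (\<lambda>i. i div 5) (\<lambda>j. j div 5) (map_prod (\<lambda>i. 5 * i + 2) (\<lambda>j. 5 * j + 2) x) = x"
        by (simp only: ij map_prod_simp dv)
    qed
    then show ?thesis by (simp only: F_nth sum_distrib_left)
  qed
qed

section \<open>Divisibility in the localization at a prime\<close>

text \<open>Membership of \<open>x\<close> in p^k times the localization of the integers at
  \<open>p\<close>; \<open>d\<close> clears a denominator prime to \<open>p\<close>. No valuation is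
  involved, so 0 is not a special case.\<close>

definition padic_dvd :: "nat \<Rightarrow> nat \<Rightarrow> rat \<Rightarrow> bool" where
  "padic_dvd p k x \<longleftrightarrow> (\<exists>d a :: int. coprime d (int p) \<and> of_int d * x = of_int (int p ^ k * a))"

lemma padic_dvd_mult:
  assumes "padic_dvd p k x" "padic_dvd p l y"
  shows "padic_dvd p (k + l) (x * y)"
proof -
  obtain d a e b :: int where "coprime d (int p)" "of_int d * x = of_int (int p ^ k * a)"
    "coprime e (int p)" "of_int e * y = of_int (int p ^ l * b)"
    using assms by (auto simp: padic_dvd_def)
  moreover from this have "of_int (d * e) * (x * y) = of_int (int p ^ (k + l) * (a * b))"
    by (metis (no_types, opaque_lifting) mult.assoc mult.left_commute of_int_mult power_add)
  ultimately show ?thesis unfolding padic_dvd_def by (meson coprime_mult_left_iff)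
qed

lemma padic_dvd_add:
  assumes "padic_dvd p k x" "padic_dvd p k y"
  shows "padic_dvd p k (x + y)"
proof -
  obtain d a e b :: int where *: "coprime d (int p)" "of_int d * x = of_int (int p ^ k * a)"
    "coprime e (int p)" "of_int e * y = of_int (int p ^ k * b)"
    using assms by (auto simp: padic_dvd_def)
  have "of_int (d * e) * (x + y) = of_int e * (of_int d * x) + of_int d * (of_int e * y)"
    by (simp add: algebra_simps)
  also have "\<dots> = of_int (int p ^ k * (e * a + d * b))"
    unfolding * by (simp add: algebra_simps)
  finally show ?thesis using * unfolding padic_dvd_def by (meson coprime_mult_left_iff)
qed

lemma padic_dvd_mono:
  assumes "padic_dvd p k x" "l \<le> k"
  shows "padic_dvd p l x"
proof -
  obtain d a :: int where "coprime d (int p)" "of_int d * x = of_int (int p ^ k * a)"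
    using assms by (auto simp: padic_dvd_def)
  moreover have "int p ^ k * a = int p ^ l * (int p ^ (k - l) * a)"
    using assms(2) by (simp flip: power_add mult.assoc)
  ultimately show ?thesis unfolding padic_dvd_def by metis
qed

lemma padic_dvd_of_int: "int p ^ k dvd a \<Longrightarrow> padic_dvd p k (of_int a)"
  unfolding padic_dvd_def by (rule exI[of _ 1]) (auto simp: dvd_def)

lemma padic_dvd_0: "padic_dvd p k 0"
  using padic_dvd_of_int[of p k 0] by simp

lemma padic_dvd_1: "padic_dvd p 0 1"
  using padic_dvd_of_int[of p 0 1] by simp

lemma padic_dvd_uminus: "padic_dvd p k x \<Longrightarrow> padic_dvd p k (- x)"
  using padic_dvd_mult[of p 0 "-1" k x] padic_dvd_of_int[of p 0 "-1"] by simp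

lemma padic_dvd_diff: "padic_dvd p k x \<Longrightarrow> padic_dvd p k y \<Longrightarrow> padic_dvd p k (x - y)"
  using padic_dvd_add[of p k x "- y"] padic_dvd_uminus[of p k y] by simp

lemma padic_dvd_sum: "(\<And>i. i \<in> A \<Longrightarrow> padic_dvd p k (f i)) \<Longrightarrow> padic_dvd p k (sum f A)"
  by (induction A rule: infinite_finite_induct) (simp_all add: padic_dvd_add padic_dvd_0)

lemma padic_dvd_cancel_unit:
  assumes "coprime b (int p)" "padic_dvd p k (of_int b * x)"
  shows "padic_dvd p k x"
proof -
  obtain d a :: int where "coprime d (int p)" "of_int d * (of_int b * x) = of_int (int p ^ k * a)"
    using assms by (auto simp: padic_dvd_def)
  then have "coprime (d * b) (int p)" "of_int (d * b) * x = of_int (int p ^ k * a)"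
    using assms(1) by (simp_all add: mult.assoc)
  then show ?thesis unfolding padic_dvd_def by blast
qed

lemma padic_dvd_cancel_power:
  assumes "p > 0" "padic_dvd p (k + v) (of_nat (p ^ v) * x)"
  shows "padic_dvd p k x"
proof -
  obtain d a :: int where d: "coprime d (int p)" "of_int d * (of_nat (p ^ v) * x) = of_int (int p ^ (k + v) * a)"
    using assms by (auto simp: padic_dvd_def)
  then have "of_nat (p ^ v) * (of_int d * x) = of_nat (p ^ v) * (of_int (int p ^ k * a) :: rat)"
    by (simp add: power_add mult_ac)
  then have "of_int d * x = of_int (int p ^ k * a)" using assms(1) by simp
  with d show ?thesis unfolding padic_dvd_def by blast
qed

lemma padic_dvd_imp_rat_cong_0:
  assumes "padic_dvd p k x"
  shows "rat_cong_0 x (p ^ k)"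
proof -
  obtain d a :: int where d: "coprime d (int p)" "of_int d * x = of_int (int p ^ k * a)"
    using assms by (auto simp: padic_dvd_def)
  obtain u v where uv: "quotient_of x = (u, v)" by force
  have "v > 0" using quotient_of_denom_pos[OF uv] .
  have "x = of_int u / of_int v" using quotient_of_div[OF uv] .
  with d(2) \<open>v > 0\<close> have "of_int (d * u) = (of_int (int p ^ k * a * v) :: rat)"
    by (simp add: field_simps)
  then have "d * u = int p ^ k * a * v" by (simp only: of_int_eq_iff)
  then have "int p ^ k dvd d * u" by (simp add: mult.assoc)
  moreover have "coprime (int p ^ k) d" using d(1) by (simp add: coprime_commute)
  ultimately have "int p ^ k dvd u" by (simp add: coprime_dvd_mult_right_iff)
  then show ?thesis by (simp add: rat_cong_0_def uv)
qed

section \<open>Power series with p-integral coefficients\<close>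

definition padic_fps :: "nat \<Rightarrow> rat fps \<Rightarrow> bool" where
  "padic_fps p f \<longleftrightarrow> (\<forall>n. padic_dvd p 0 (f $ n))"

lemma padic_fps_mult: "padic_fps p f \<Longrightarrow> padic_fps p g \<Longrightarrow> padic_fps p (f * g)"
  unfolding padic_fps_def fps_mult_nth
  using padic_dvd_mult[of p 0 _ 0] by (auto intro!: padic_dvd_sum)

lemma padic_fps_diff: "padic_fps p f \<Longrightarrow> padic_fps p g \<Longrightarrow> padic_fps p (f - g)"
  by (simp add: padic_fps_def padic_dvd_diff)

lemma padic_fps_1: "padic_fps p 1"
  by (simp add: padic_fps_def padic_dvd_0 padic_dvd_1)

lemma padic_fps_X_power: "padic_fps p (fps_X ^ k)"
  by (simp add: padic_fps_def padic_dvd_0 padic_dvd_1 fps_X_power_nth)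

lemma padic_fps_power: "padic_fps p f \<Longrightarrow> padic_fps p (f ^ k)"
  by (induction k) (simp_all add: padic_fps_mult padic_fps_1)

lemma padic_fps_prod: "(\<And>i. i \<in> A \<Longrightarrow> padic_fps p (f i)) \<Longrightarrow> padic_fps p (prod f A)"
  by (induction A rule: infinite_finite_induct) (simp_all add: padic_fps_mult padic_fps_1)

lemma padic_fps_deriv:
  assumes "padic_fps p f"
  shows "padic_fps p (fps_deriv f)"
  unfolding padic_fps_def
proof
  fix n
  have "padic_dvd p (0 + 0) (of_int (int n + 1) * f $ (n + 1))"
    using assms by (intro padic_dvd_mult padic_dvd_of_int) (simp_all add: padic_fps_def)
  then show "padic_dvd p 0 (fps_deriv f $ n)" by (simp add: add.commute)
qed

lemma padic_fps_euler: "c > 0 \<Longrightarrow> padic_fps p (euler c)"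
  unfolding padic_fps_def
proof
  fix n assume "c > 0"
  then have "euler c $ n = (\<Prod>j<Suc n. 1 - (fps_X ^ c) ^ Suc j) $ n"
    using fps_agreeD[OF euler_agree[of c n "Suc n"], of n] by simp
  moreover have "padic_fps p (\<Prod>j<Suc n. 1 - (fps_X ^ c) ^ Suc j)"
    by (intro padic_fps_prod padic_fps_diff padic_fps_power padic_fps_X_power padic_fps_1)
  ultimately show "padic_dvd p 0 (euler c $ n)" by (simp add: padic_fps_def del: prod.lessThan_Suc)
qed

text \<open>The binomial expansion to first order: modulo \<open>fps_X ^ Suc n\<close> the
  correction is \<open>b\<close> times the constant term of \<open>r\<close>, because
  \<open>T\<close> has constant term 1.\<close>

lemma fps_power_add_X_power:
  fixes T r :: "'a::comm_ring_1 fps"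
  assumes "T $ 0 = 1" "n > 0"
  shows "\<exists>s. (T + fps_X ^ n * r) ^ b = T ^ b + fps_X ^ n * s \<and> s $ 0 = of_nat b * r $ 0"
proof (induction b)
  case (Suc b)
  then obtain s where s: "(T + fps_X ^ n * r) ^ b = T ^ b + fps_X ^ n * s" "s $ 0 = of_nat b * r $ 0"
    by blast
  show ?case
  proof (intro exI conjI)
    show "(T + fps_X ^ n * r) ^ Suc b = T ^ Suc b + fps_X ^ n * (T * s + r * T ^ b + fps_X ^ n * (r * s))"
      unfolding power_Suc s(1) by (simp add: algebra_simps)
    show "(T * s + r * T ^ b + fps_X ^ n * (r * s)) $ 0 = of_nat (Suc b) * r $ 0"
      using assms by (simp add: s(2) algebra_simps fps_power_zeroth zero_power)
  qed
qed (auto intro: exI[of _ 0])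

text \<open>By strong induction: the coefficient at \<open>n\<close> of \<open>g ^ b * V\<close> is
  \<open>b * g $ n\<close> plus an expression in the earlier coefficients of \<open>g\<close>,
  gathered in the cutoff \<open>T\<close>. Since \<open>b\<close> is a unit at \<open>p\<close>, it
  can be divided out.\<close>

lemma padic_fps_root_inverse:
  assumes g: "g ^ b * V = 1" "g $ 0 = 1" and V: "padic_fps p V" and b: "coprime (int b) (int p)"
  shows "padic_fps p g"
  unfolding padic_fps_def
proof
  fix n
  show "padic_dvd p 0 (g $ n)"
  proof (induction n rule: less_induct)
    case (less n)
    show ?case
    proof (cases "n = 0")
      case True
      then show ?thesis using g by (simp add: padic_dvd_1)
    next
      case False
      define T where "T = fps_cutoff n g"
      define r where "r = fps_shift n g"
      have T: "padic_fps p T" using less by (simp add: T_def padic_fps_def padic_dvd_0)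
      have T0: "T $ 0 = 1" using False g by (simp add: T_def)
      have g_eq: "g = T + fps_X ^ n * r"
        unfolding T_def r_def using fps_shift_cutoff'[of n g] by (simp add: add.commute)
      have V0: "V $ 0 = 1"
        using arg_cong[OF g(1), of "\<lambda>f. f $ 0"] g(2) by (simp add: fps_power_zeroth)
      obtain s where s: "g ^ b = T ^ b + fps_X ^ n * s" "s $ 0 = of_nat b * r $ 0"
        using fps_power_add_X_power[OF T0, of n r b] False unfolding g_eq[symmetric] by blast
      have "g ^ b * V = T ^ b * V + fps_X ^ n * (s * V)"
        unfolding s(1) by (simp add: algebra_simps)
      then have "(T ^ b * V) $ n + (fps_X ^ n * (s * V)) $ n = 1 $ n"
        unfolding g(1) by (metis fps_add_nth)
      then have "of_int (int b) * g $ n = - (T ^ b * V) $ n"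
        using False s(2) V0 by (simp add: fps_X_power_mult_nth r_def eq_neg_iff_add_eq_0 add.commute)
      moreover have "padic_dvd p 0 (- (T ^ b * V) $ n)"
        using padic_fps_mult[OF padic_fps_power[OF T] V] by (simp add: padic_fps_def padic_dvd_uminus)
      ultimately show ?thesis using padic_dvd_cancel_unit[OF b] by metis
    qed
  qed
qed

section \<open>Laws for rational powers of the infinite product\<close>

lemma fps_rat_power_add:
  assumes "f $ 0 = 1"
  shows "fps_rat_power f (t + u) = fps_rat_power f t * fps_rat_power f u"
  using assms by (simp add: fps_rat_power_def fps_binomial_add_mult fps_compose_mult_distrib)

lemma fps_rat_power_of_nat:
  assumes "f $ 0 = 1"
  shows "fps_rat_power f (of_nat k) = f ^ k"
  using assms by (simp add: fps_rat_power_def fps_binomial_of_nat fps_compose_add_distrib flip: fps_compose_power)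

text \<open>Convergence is coefficientwise, so the finitely many coefficients up to \<open>n\<close>
  become stationary. Identities between the factors thereby pass to
  \<open>euler_power\<close>.\<close>

lemma eventually_euler_power:
  assumes "m \<ge> 1"
  shows "\<forall>\<^sub>F N in sequentially. fps_agree n (euler_power m t)
     (\<Prod>j\<le>N. fps_rat_power ((1 - fps_X ^ Suc j) * (1 - fps_X ^ (m * Suc j))) t)"
proof -
  have "(\<lambda>N. \<Prod>j\<le>N. fps_rat_power ((1 - fps_X ^ Suc j) * (1 - fps_X ^ (m * Suc j))) t) \<longlonglongrightarrow> euler_power m t"
    using has_prod_imp_tendsto[OF has_prod_euler_power[OF assms]] .
  then have "\<forall>\<^sub>F N in sequentially. \<forall>i\<in>{..n}.
      (\<Prod>j\<le>N. fps_rat_power ((1 - fps_X ^ Suc j) * (1 - fps_X ^ (m * Suc j))) t) $ i = euler_power m t $ i"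
    by (intro eventually_ball_finite) (auto simp: tendsto_fps_iff)
  then show ?thesis by eventually_elim (simp add: fps_agree_def)
qed

lemma euler_power_add:
  assumes m: "m \<ge> 1"
  shows "euler_power m (t + u) = euler_power m t * euler_power m u"
proof (rule fps_eqI_agree)
  fix n
  let ?f = "\<lambda>j. (1 - fps_X ^ Suc j) * (1 - fps_X ^ (m * Suc j)) :: rat fps"
  have f0: "?f j $ 0 = 1" for j using m by simp
  have "\<forall>\<^sub>F N in sequentially. fps_agree n (euler_power m (t + u)) (euler_power m t * euler_power m u)"
    using eventually_euler_power[OF m, of n "t + u"] eventually_euler_power[OF m, of n t]
      eventually_euler_power[OF m, of n u]
  proof eventually_elim
    case (elim N)
    note elim(1)
    also have "(\<Prod>j\<le>N. fps_rat_power (?f j) (t + u)) = (\<Prod>j\<le>N. fps_rat_power (?f j) t) * (\<Prod>j\<le>N. fps_rat_power (?f j) u)"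
      unfolding prod.distrib [symmetric] by (intro prod.cong refl fps_rat_power_add f0)
    also have "fps_agree n \<dots> (euler_power m t * euler_power m u)"
      by (intro fps_agree_mult fps_agree_sym[OF elim(2)] fps_agree_sym[OF elim(3)])
    finally show ?case .
  qed
  then show "fps_agree n (euler_power m (t + u)) (euler_power m t * euler_power m u)"
    by simp
qed

lemma euler_power_of_nat:
  assumes m: "m \<ge> 1"
  shows "euler_power m (of_nat k) = (euler 1 * euler m) ^ k"
proof (rule fps_eqI_agree)
  fix n
  let ?f = "\<lambda>j. (1 - fps_X ^ Suc j) * (1 - fps_X ^ (m * Suc j)) :: rat fps"
  have f0: "?f j $ 0 = 1" for j using m by simp
  have pow: "fps_agree n f g \<Longrightarrow> fps_agree n (f ^ k) (g ^ k)" for f g :: "rat fps"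
    by (induction k) (simp_all add: fps_agree_mult)
  have "\<forall>\<^sub>F N in sequentially. fps_agree n (euler_power m (of_nat k)) ((euler 1 * euler m) ^ k)"
    using eventually_euler_power[OF m, of n "of_nat k"] eventually_ge_at_top[of n]
  proof eventually_elim
    case (elim N)
    note elim(1)
    also have "(\<Prod>j\<le>N. fps_rat_power (?f j) (of_nat k)) = (\<Prod>j\<le>N. ?f j ^ k)"
      by (intro prod.cong refl fps_rat_power_of_nat f0)
    also have "\<dots> = ((\<Prod>j<Suc N. 1 - (fps_X ^ 1) ^ Suc j) * (\<Prod>j<Suc N. 1 - (fps_X ^ m) ^ Suc j)) ^ k"
      unfolding prod_power_distrib [symmetric] prod.distrib [symmetric] lessThan_Suc_atMost power_mult power_one_right ..
    also have "fps_agree n \<dots> ((euler 1 * euler m) ^ k)"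
      by (intro pow fps_agree_mult fps_agree_sym[OF euler_agree]) (use m elim(2) in auto)
    finally show ?case .
  qed
  then show "fps_agree n (euler_power m (of_nat k)) ((euler 1 * euler m) ^ k)"
    by simp
qed

lemma euler_power_nth_0: "m \<ge> 1 \<Longrightarrow> euler_power m t $ 0 = 1"
proof -
  assume "m \<ge> 1"
  from eventually_euler_power[OF this, of 0 t] obtain N where
    "fps_agree 0 (euler_power m t) (\<Prod>j\<le>N. fps_rat_power ((1 - fps_X ^ Suc j) * (1 - fps_X ^ (m * Suc j))) t)"
    using eventually_happens'[OF sequentially_bot] by blast
  moreover have "(\<Prod>j\<le>N. fps_rat_power (f j) t) $ 0 = 1" for f
    by (induction N) (simp_all add: fps_rat_power_nth_0)
  ultimately show ?thesis by (simp add: fps_agree_def)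
qed

lemma euler_power_mult_of_nat:
  assumes m: "m \<ge> 1"
  shows "euler_power m (of_nat b * t) = euler_power m t ^ b"
proof (induction b)
  case 0
  show ?case using euler_power_of_nat[OF m, of 0] by simp
next
  case (Suc b)
  have "of_nat (Suc b) * t = t + of_nat b * t" by (simp add: algebra_simps)
  then show ?case using Suc by (simp only: euler_power_add[OF m] power_Suc)
qed

text \<open>\<open>H\<close> is the \<open>b\<close>-th root of the inverse of \<open>W ^ q\<close>,
  hence p-integral. Its derivative is \<open>q / b\<close> times a p-integral series, which makes
  \<open>n * H $ n\<close>, rather than \<open>H $ n\<close>, divisible by
  \<open>p ^ k\<close>.\<close>

lemma padic_dvd_euler_power:
  fixes m p b k n :: nat
  assumes m: "m \<ge> 1" and p: "p > 0" and b: "b > 0" "coprime (int b) (int p)"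
  defines "H \<equiv> euler_power m (- (of_nat (p ^ k) / of_nat b))"
  shows "padic_dvd p k (of_nat n * H $ n)"
proof (cases n)
  case (Suc n')
  define W where "W = (euler 1 * euler m :: rat fps)"
  define q where "q = p ^ k"
  have q: "q = Suc (q - 1)" "b = Suc (b - 1)" using p b by (simp_all add: q_def)
  have H0: "H $ 0 = 1" unfolding H_def by (rule euler_power_nth_0[OF m])
  have "H ^ b = euler_power m (- of_nat q)"
    using b(1) by (simp add: H_def q_def flip: euler_power_mult_of_nat[OF m])
  moreover have "W ^ q = euler_power m (of_nat q)"
    by (simp only: W_def euler_power_of_nat[OF m])
  ultimately have HW: "H ^ b * W ^ q = 1"
    using euler_power_of_nat[OF m, of 0] by (simp flip: euler_power_add[OF m])
  have W: "padic_fps p W"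
    unfolding W_def by (intro padic_fps_mult padic_fps_euler) (use m in auto)
  have H: "padic_fps p H"
    using HW H0 padic_fps_power[OF W] b(2) by (rule padic_fps_root_inverse)
  \<comment> \<open>Differentiating \<open>H\<^sup>b W\<^sup>q = 1\<close> makes \<open>b H'\<close> a multiple of \<open>q\<close>.\<close>
  have "fps_deriv (H ^ b * W ^ q) = 0" unfolding HW by simp
  then have "of_nat b * H ^ (b - 1) * fps_deriv H * W ^ q + H ^ b * (of_nat q * W ^ (q - 1) * fps_deriv W) = 0"
    by (simp add: fps_deriv_power' algebra_simps)
  \<comment> \<open>The extra \<open>H\<close> completes \<open>H ^ (b - 1)\<close> to
    \<open>H ^ b\<close>, so that \<open>HW\<close> applies.\<close>
  then have "H * (of_nat b * H ^ (b - 1) * fps_deriv H * W ^ q + H ^ b * (of_nat q * W ^ (q - 1) * fps_deriv W)) = 0"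
    by (simp only: mult_zero_right)
  then have "of_nat b * (H * H ^ (b - 1) * W ^ q) * fps_deriv H + of_nat q * (H ^ b * H * W ^ (q - 1) * fps_deriv W) = 0"
    by (simp only: distrib_left mult_ac)
  also have "H * H ^ (b - 1) = H ^ b" by (subst (2) q(2)) simp
  finally have eq: "of_nat b * fps_deriv H = - (of_nat q * (H ^ b * H * W ^ (q - 1) * fps_deriv W))"
    unfolding HW by (simp add: eq_neg_iff_add_eq_0)
  let ?G = "H ^ b * H * W ^ (q - 1) * fps_deriv W"
  have nth: "(of_nat c * f) $ i = of_nat c * f $ i" for c i and f :: "rat fps"
    by (simp flip: fps_of_nat)
  \<comment> \<open>With \<open>n = Suc n'\<close>, the coefficient of \<open>fps_deriv H\<close> at
    \<open>n'\<close> is \<open>n * H $ n\<close>.\<close>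
  have "of_int (int b) * (of_nat n * H $ n) = - (of_int (int q) * ?G $ n')"
    using arg_cong[OF eq, of "\<lambda>f. f $ n'"] by (simp add: nth Suc)
  moreover have "padic_fps p ?G"
    by (intro padic_fps_mult padic_fps_power padic_fps_deriv H W)
  then have "padic_dvd p (k + 0) (of_int (int q) * ?G $ n')"
    by (intro padic_dvd_mult padic_dvd_of_int) (simp_all add: q_def padic_fps_def)
  then have "padic_dvd p k (- (of_int (int q) * ?G $ n'))" by (intro padic_dvd_uminus) simp
  ultimately show ?thesis using padic_dvd_cancel_unit[OF b(2)] by metis
qed (simp add: padic_dvd_0)

section \<open>Coefficients indexed by an arithmetic progression\<close>

text \<open>The common properties of the three products. As \<open>p ^ 2\<close> is 1 modulo 8, the
  progression of numbers \<open>8 * n + \<beta>\<close> is stable under multiplication and exact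
  division by \<open>p ^ 2\<close>.\<close>

locale square_scaling =
  fixes p :: nat and \<beta> :: nat and F :: "rat fps" and c :: int
  assumes p: "prime p" "p ^ 2 mod 8 = 1" and \<beta>: "\<beta> < 8" and c: "int p ^ 2 dvd c"
    and integral: "padic_fps p F"
    and vanish: "p dvd 8 * n + \<beta> \<Longrightarrow> \<not> p ^ 2 dvd 8 * n + \<beta> \<Longrightarrow> F $ n = 0"
    and scale: "8 * n + \<beta> = p ^ 2 * (8 * n' + \<beta>) \<Longrightarrow> F $ n = of_int c * F $ n'"
begin

lemma square_dvd_obtains:
  assumes "p ^ 2 dvd 8 * n + \<beta>"
  obtains n' where "8 * n + \<beta> = p ^ 2 * (8 * n' + \<beta>)"
proof -
  obtain e where e: "8 * n + \<beta> = p ^ 2 * e" using assms by (rule dvdE)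
  have "e mod 8 = (p ^ 2 * e) mod 8"
    using p(2) mod_mult_left_eq[of "p ^ 2" 8 e] by simp
  also have "\<dots> = \<beta>" using \<beta> by (simp flip: e)
  finally have "e = 8 * (e div 8) + \<beta>" by presburger
  with e show thesis by (metis that)
qed

text \<open>Dividing the index by \<open>p ^ 2\<close> costs two powers of \<open>p\<close>, which
  the factor \<open>c\<close> returns. A single power either extends to \<open>p ^ 2\<close> or
  meets \<open>vanish\<close>.\<close>

lemma padic_dvd_nth: "p ^ v dvd 8 * n + \<beta> \<Longrightarrow> padic_dvd p v (F $ n)"
proof (induction v arbitrary: n rule: less_induct)
  case (less v)
  \<comment> \<open>Requiring \<open>w < v\<close> instead of \<open>v = Suc (Suc w)\<close> makes
    this usable for \<open>v = 1\<close> too, when \<open>p ^ 2\<close> happens to divide the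
    index.\<close>
  have step: "padic_dvd p (Suc (Suc w)) (F $ n)" if w: "w < v" "p ^ Suc (Suc w) dvd 8 * n + \<beta>" for w
  proof -
    have p2: "p ^ Suc (Suc w) = p ^ 2 * p ^ w" by (simp add: power2_eq_square)
    with w have "p ^ 2 dvd 8 * n + \<beta>" by (metis dvd_mult_left)
    then obtain n' where n': "8 * n + \<beta> = p ^ 2 * (8 * n' + \<beta>)" by (rule square_dvd_obtains)
    have "p ^ w dvd 8 * n' + \<beta>"
      using w p(1) unfolding n' p2 by (simp add: prime_gt_0_nat)
    then have "padic_dvd p (2 + w) (of_int c * F $ n')"
      using less.IH w c by (intro padic_dvd_mult padic_dvd_of_int) auto
    then show ?thesis by (simp add: scale[OF n'])
  qed
  consider "v = 0" | "v = 1" | w where "v = Suc (Suc w)" by (metis One_nat_def not0_implies_Suc)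
  then show ?case
  proof cases
    case 1
    then show ?thesis using integral by (simp add: padic_fps_def)
  next
    case 2
    show ?thesis
    proof (cases "p ^ 2 dvd 8 * n + \<beta>")
      case True
      then have "padic_dvd p (Suc (Suc 0)) (F $ n)" using 2 by (intro step) (simp_all add: numeral_2_eq_2)
      then show ?thesis using 2 by (elim padic_dvd_mono) simp
    next
      case False
      with vanish[of n] 2 less.prems show ?thesis by (simp add: padic_dvd_0)
    qed
  next
    case 3
    with step less.prems show ?thesis by simp
  qed
qed

text \<open>Dividing the index by \<open>p ^ 2\<close> repeatedly, \<open>u\<close> times, leads to
  valuation one, where \<open>vanish\<close> applies.\<close>

lemma odd_valuation_nth:
  "p ^ (2 * u + 1) dvd 8 * n + \<beta> \<Longrightarrow> \<not> p ^ (2 * u + 2) dvd 8 * n + \<beta> \<Longrightarrow> F $ n = 0"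
proof (induction u arbitrary: n)
  case 0
  then show ?case using vanish[of n] by (simp add: numeral_2_eq_2)
next
  case (Suc u)
  have p2: "p ^ (2 * Suc u + 1) = p ^ 2 * p ^ (2 * u + 1)" "p ^ (2 * Suc u + 2) = p ^ 2 * p ^ (2 * u + 2)"
    by (simp_all add: power2_eq_square)
  then have "p ^ 2 dvd 8 * n + \<beta>" using Suc.prems by (metis dvd_mult_left)
  then obtain n' where n': "8 * n + \<beta> = p ^ 2 * (8 * n' + \<beta>)" by (rule square_dvd_obtains)
  have "p ^ 2 * a dvd p ^ 2 * b \<longleftrightarrow> a dvd b" for a b
    using p(1) by (simp add: prime_gt_0_nat)
  with Suc have "F $ n' = 0" unfolding n' p2 by blast
  then show ?case by (simp add: scale[OF n'])
qed

text \<open>Let \<open>v\<close> be the valuation of \<open>i\<close>. If \<open>i = 0\<close> or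
  \<open>v \<ge> 2 * u + 2\<close>, then \<open>8 * (n - i) + \<beta>\<close> keeps the odd
  valuation \<open>2 * u + 1\<close> and the summand is 0. Otherwise \<open>F\<close> contributes
  \<open>p ^ v\<close> and \<open>H\<close> contributes \<open>p ^ (k - v)\<close>.\<close>

lemma padic_dvd_mult_nth:
  assumes H: "\<And>i. padic_dvd p k (of_nat i * H $ i)" and k: "2 * u + 1 \<le> k"
    and n: "p ^ (2 * u + 1) dvd 8 * n + \<beta>" "\<not> p ^ (2 * u + 2) dvd 8 * n + \<beta>"
  shows "padic_dvd p k ((F * H) $ n)"
proof -
  have "padic_dvd p k (F $ (n - i) * H $ i)" if i: "i \<le> n" for i
  proof (cases "i = 0")
    case True
    with odd_valuation_nth[OF n] show ?thesis by (simp add: padic_dvd_0)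
  next
    case False
    obtain v w where vw: "i = p ^ v * w" "\<not> p dvd w"
      using multiplicity_decompose'[of i p] False p(1) by (metis not_prime_unit)
    have dvd_iff: "d dvd 8 * (n - i) + \<beta> \<longleftrightarrow> d dvd 8 * n + \<beta>" if "d dvd 8 * i" for d
    proof -
      have "8 * n + \<beta> = 8 * (n - i) + \<beta> + 8 * i" using i by simp
      with that show ?thesis by (simp only: dvd_add_left_iff)
    qed
    have pow_dvd: "p ^ a dvd 8 * i" if "a \<le> v" for a
      unfolding vw(1) by (rule dvd_mult[OF dvd_mult2[OF le_imp_power_dvd[OF that]]])
    show ?thesis
    proof (cases "2 * u + 2 \<le> v")
      case True
      then have "p ^ (2 * u + 2) dvd 8 * i" "p ^ (2 * u + 1) dvd 8 * i"
        by (intro pow_dvd; linarith)+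
      note this[THEN dvd_iff]
      with n odd_valuation_nth[of u "n - i"] have "F $ (n - i) = 0" by blast
      then show ?thesis by (simp add: padic_dvd_0)
    next
      case False
      then have v: "v \<le> 2 * u + 1" by simp
      then have "p ^ v dvd 8 * n + \<beta>" using n(1) by (metis dvd_trans le_imp_power_dvd)
      moreover have "p ^ v dvd 8 * i" unfolding vw by simp
      ultimately have "p ^ v dvd 8 * (n - i) + \<beta>" by (simp only: dvd_iff)
      then have Fv: "padic_dvd p v (F $ (n - i))" by (rule padic_dvd_nth)
      have "padic_dvd p (k - v + v) (of_nat (p ^ v) * (of_int (int w) * H $ i))"
        using H[of i] v k by (simp add: vw(1) mult.assoc)
      then have "padic_dvd p (k - v) (of_int (int w) * H $ i)"
        by (rule padic_dvd_cancel_power[OF prime_gt_0_nat[OF p(1)]])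
      moreover have "coprime (int w) (int p)"
        using prime_imp_coprime[OF p(1) vw(2)] by (simp add: coprime_commute)
      ultimately have "padic_dvd p (k - v) (H $ i)" by (metis padic_dvd_cancel_unit)
      with Fv have "padic_dvd p (v + (k - v)) (F $ (n - i) * H $ i)" by (rule padic_dvd_mult)
      with v k show ?thesis by simp
    qed
  qed
  then have "padic_dvd p k (\<Sum>i=0..n. H $ i * F $ (n - i))"
    by (intro padic_dvd_sum) (simp add: mult.commute)
  then show ?thesis by (subst mult.commute) (simp only: fps_mult_nth)
qed

end

lemma padic_fps_euler_pair: "m > 0 \<Longrightarrow> padic_fps p ((euler 1 * euler m) ^ r)"
  by (intro padic_fps_power padic_fps_mult padic_fps_euler) auto

text \<open>The exponent is \<open>r - p ^ k / b\<close>, so the series factors into an integral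
  power and the series \<open>?H\<close>. The form of \<open>8 * n + \<beta>\<close> fixes its
  valuation at the odd number \<open>2 * u + 1\<close>.\<close>

lemma rat_cong_0_p1:
  assumes F: "square_scaling p \<beta> ((euler 1 * euler m) ^ r) c" and m: "m \<ge> 1"
    and b: "b > 0" "coprime b (int p)" and k: "2 * u + 1 \<le> k"
    and n: "8 * n + \<beta> = p ^ (2 * u + 1) * w" "\<not> p dvd w"
  shows "rat_cong_0 (p1 m (- ((of_nat p ^ k - of_nat r * of_int b) / of_int b)) n) (p ^ k)"
proof -
  interpret square_scaling p \<beta> "(euler 1 * euler m) ^ r" c by (rule F)
  define b' where "b' = nat b"
  have b': "b = int b'" "b' > 0" using b(1) by (simp_all add: b'_def)
  let ?H = "euler_power m (- (of_nat (p ^ k) / of_nat b'))"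
  have t: "- ((of_nat p ^ k - of_nat r * of_int b) / of_int b)
      = of_nat r + - (of_nat (p ^ k) / of_nat b' :: rat)"
    using b' by (simp add: field_simps)
  have "padic_dvd p k (((euler 1 * euler m) ^ r * ?H) $ n)"
  proof (rule padic_dvd_mult_nth[OF _ k])
    show "padic_dvd p k (of_nat i * ?H $ i)" for i
      using b b' p(1) m by (intro padic_dvd_euler_power) (auto simp: prime_gt_0_nat)
    show "p ^ (2 * u + 1) dvd 8 * n + \<beta>" unfolding n(1) by simp
    have "p ^ (2 * u + 2) = p ^ (2 * u + 1) * p" by simp
    then show "\<not> p ^ (2 * u + 2) dvd 8 * n + \<beta>"
      using n(2) p(1) unfolding n(1) by (simp add: prime_gt_0_nat del: power_Suc)
  qed
  then show ?thesis
    unfolding p1_def t euler_power_add[OF m] euler_power_of_nat[OF m] by (rule padic_dvd_imp_rat_cong_0)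
qed

lemma square_scaling_two_five: "square_scaling 3 5 ((euler 1 * euler 2) ^ 5) (- 81)"
  by unfold_locales
    (use euler_1_2_fifth_power_nth in \<open>simp_all add: padic_fps_euler_pair del: One_nat_def\<close>)

lemma square_scaling_three:
  assumes "m = 2 \<or> m = 3"
  shows "square_scaling 5 (m + 1) ((euler 1 * euler m) ^ 3) 25"
  by unfold_locales
    (use assms euler_pair_cube_nth[OF assms] in \<open>auto simp: padic_fps_euler_pair simp del: One_nat_def\<close>)

theorem theorem1p20:
  fixes k s n :: nat
  assumes "k > 1" and "s \<ge> 1" and "s \<le> k div 2"
  shows
    "(\<forall>b::int. b > 0 \<and> coprime b 3 \<longrightarrow> (\<forall>r\<in>{0, 2}.
        rat_cong_0 (p1 2 (- ((3 ^ k - 5 * of_int b) / of_int b))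
          (3 ^ (2 * s) * n + 3 ^ (2 * s - 1) * r + (7 * 3 ^ (2 * s - 1) - 5) div 8)) (3 ^ k))) \<and>
     (\<forall>b::int. b > 0 \<and> coprime b 5 \<longrightarrow> (\<forall>r\<in>{0, 2, 3, 4}.
        rat_cong_0 (p1 2 (- ((5 ^ k - 3 * of_int b) / of_int b))
          (5 ^ (2 * s) * n + 5 ^ (2 * s - 1) * r + (7 * 5 ^ (2 * s - 1) - 3) div 8)) (5 ^ k))) \<and>
     (\<forall>b::int. b > 0 \<and> coprime b 5 \<longrightarrow> (\<forall>r\<in>{0, 1, 3, 4}.
        rat_cong_0 (p1 3 (- ((5 ^ k - 3 * of_int b) / of_int b))
          (5 ^ (2 * s) * n + 5 ^ (2 * s - 1) * r + (5 ^ (2 * s - 1) - 1) div 2)) (5 ^ k)))"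
proof -
  obtain u where s: "s = Suc u" using assms(2) by (cases s) auto
  \<comment> \<open>From \<open>s \<le> k div 2\<close> the valuation \<open>2 * s - 1\<close> is at
    most \<open>k\<close>, as \<open>rat_cong_0_p1\<close> requires.\<close>
  have odd: "2 * s - 1 = 2 * u + 1" and k: "2 * u + 1 \<le> k" using s assms(3) by auto
  have even: "q ^ (2 * s) = q * q ^ (2 * u + 1)" for q :: nat by (simp add: s)
  define x y :: nat where "x = 3 ^ (2 * u + 1)" and "y = 5 ^ (2 * u + 1)"
  have ix: "8 dvd 7 * x - 5" "5 \<le> 7 * x" "8 dvd 7 * y - 3" "3 \<le> 7 * y" "2 dvd y - 1" "y > 0"
    using index_exact[OF assms(2)] unfolding odd x_def[symmetric] y_def[symmetric] by (simp_all add: y_def)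
  show ?thesis
    unfolding odd even x_def[symmetric] y_def[symmetric]
  proof (intro conjI allI impI ballI; elim conjE)
    fix b :: int and r :: nat
    assume b: "b > 0" "coprime b 3" and r: "r \<in> {0, 2}"
    have "8 * ((7 * x - 5) div 8) = 7 * x - 5" using ix by simp
    then have "8 * (3 * x * n + x * r + (7 * x - 5) div 8) + 5 = x * (24 * n + 8 * r + 7)"
      using ix(2) by (simp add: algebra_simps)
    \<comment> \<open>Modulo 3 this is \<open>2 * r + 1\<close>, which is 0 just for the excluded
      residue 1.\<close>
    moreover have "\<not> 3 dvd 24 * n + 8 * r + 7" using r by (elim insertE emptyE; simp; presburger)
    ultimately show "rat_cong_0 (p1 2 (- ((3 ^ k - 5 * of_int b) / of_int b))
        (3 * x * n + x * r + (7 * x - 5) div 8)) (3 ^ k)"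
      using rat_cong_0_p1[OF square_scaling_two_five, of b u k] b k by (simp add: x_def)
  next
    fix b :: int and r :: nat
    assume b: "b > 0" "coprime b 5" and r: "r \<in> {0, 2, 3, 4}"
    have "8 * ((7 * y - 3) div 8) = 7 * y - 3" using ix by simp
    then have "8 * (5 * y * n + y * r + (7 * y - 3) div 8) + (2 + 1) = y * (40 * n + 8 * r + 7)"
      using ix(4) by (simp add: algebra_simps)
    \<comment> \<open>Modulo 5 this is \<open>3 * r + 2\<close>, which is 0 just for the excluded
      residue 1.\<close>
    moreover have "\<not> 5 dvd 40 * n + 8 * r + 7" using r by (elim insertE emptyE; simp; presburger)
    ultimately show "rat_cong_0 (p1 2 (- ((5 ^ k - 3 * of_int b) / of_int b))
        (5 * y * n + y * r + (7 * y - 3) div 8)) (5 ^ k)"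
      using rat_cong_0_p1[OF square_scaling_three, of 2 b u k] b k by (simp add: y_def)
  next
    fix b :: int and r :: nat
    assume b: "b > 0" "coprime b 5" and r: "r \<in> {0, 1, 3, 4}"
    have "2 * ((y - 1) div 2) = y - 1" using ix by simp
    then have "8 * ((y - 1) div 2) = 4 * y - 4" by linarith
    then have "8 * (5 * y * n + y * r + (y - 1) div 2) + (3 + 1) = y * (40 * n + 8 * r + 4)"
      using ix(6) by (simp add: algebra_simps)
    \<comment> \<open>Modulo 5 this is \<open>3 * r + 4\<close>, which is 0 just for the excluded
      residue 2.\<close>
    moreover have "\<not> 5 dvd 40 * n + 8 * r + 4" using r by (elim insertE emptyE; simp; presburger)
    ultimately show "rat_cong_0 (p1 3 (- ((5 ^ k - 3 * of_int b) / of_int b))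
        (5 * y * n + y * r + (y - 1) div 2)) (5 ^ k)"
      using rat_cong_0_p1[OF square_scaling_three, of 3 b u k] b k by (simp add: y_def)
  qed
qed

end
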